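(* Let $f:2^N\to\mathbb{R}$ be a monotone subadditive function with $f(\emptyset)=0$ on a finite ground set $N$ of size $n$, with a known weak submodular order $\pi$. Let $b_i>0$ ($i\in N$), $B>0$, $b(S)=\sum_{i\in S}b_i$, and $\mathrm{OPT}=\max\{f(S): S\subseteq N,\ b(S)\le B\}$. For the problem of maximizing $f(S)$ subject to $b(S)\le B$: (i) For every $\epsilon\in(0,1)$, the algorithm Threshold-Budget described in the context is $(1-\epsilon)/3$ approximate, i.e. it outputs a set $S$ with $b(S)\le B$ and $f(S)\ge\frac{1-\epsilon}{3}\,\mathrm{OPT}$, with query complexity $O\!\left(\frac n\epsilon\log n\right)$. (ii) For every $\epsilon\in(0,0.5)$, the algorithm Enumerate-Budget described in the context is $0.5-\epsilon$ approximate, i.e. it outputs a set $S$ with $b(S)\le B$ and $f(S)\ge(0.5-\epsilon)\,\mathrm{OPT}$, with query complexity $O\!\left(\frac1\epsilon\,n^{1+\frac1\epsilon}\log n\right)$.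
   Context: Notation: $f(X\mid S)=f(X\cup S)-f(S)$, and $f(e\mid S)=f(\{e\}\mid S)$. $f$ is monotone if $f(A)\ge f(A')$ whenever $A'\subseteq A$, and subadditive if $f(A)+f(A')\ge f(A\cup A')$ for all $A,A'$. Query complexity is the number of queries to a value oracle, which returns $f(S)$ for a queried set $S$. "Best" means largest $f$-value. For a permutation $\pi$ of $N$, viewed as a left-to-right ordering, $l_\pi(S)$ and $r_\pi(S)$ denote the leftmost and rightmost elements of $S$ (inequalities compare positions in $\pi$ and are vacuous for empty sets). Sets $A'\subseteq A$ are $\pi$-nested if $l_\pi(A\setminus A')>r_\pi(A')$. The permutation $\pi$ is a weak submodular order for $f$ if $f(C\mid A)\le f(C\mid A')$ for all $\pi$-nested $A'\subseteq A$ and every $C$ with $l_\pi(C)>r_\pi(A)$. Algorithm Threshold-Budget (input $B,\epsilon$): elements $e$ with $b_e>B$ are ignored; let the elements be indexed $1,2,\dots,n$ in the order $\pi$. Set $\tau=\frac1B\max_{e}f(\{e\})$. For each $i\in\{1,\dots,\lceil\log_{1+\epsilon}n\rceil\}$ let $\tau_i=(1+\epsilon)^{i-1}\tau$ and build $S_i$: start with $S_i=\emptyset$; parse the elements $j=1,2,\dots,n$ in order while $b(S_i)<B$, and add $j$ to $S_i$ whenever $b_j<B-b(S_i)$ and $f(j\mid S_i)/b_j\ge\tau_i$. Output the best of all singletons and all the sets $S_i$. Algorithm Enumerate-Budget (input $B,\epsilon$): let $E=\{X\subseteq N: b(X)\le B,\ |X|\le 1/\epsilon\}$. For each $X\in E$: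 - Filter the ground set: let $N_X$ be obtained from $N$ by removing every element $e\notin X$ with $b_e>\min_{i\in X}b_i$ (no element is removed if $X=\emptyset$). Set $\tau=\frac1B\max_{e\in N_X}f(\{e\})$. - For each $i\in\{1,\dots,\lceil\log_{1+\epsilon}|N_X|\rceil\}$ start with $S_i=\emptyset$ and parse the elements $j$ of $N_X$ in the order $\pi$ while $b(S_i)<B$. If $f(j\mid S_i)/b_j\ge(1+\epsilon)^{i-1}\tau$, then: if $b_j+b(S_i)\le B$, replace $S_i$ by $S_i\cup\{j\}$; otherwise replace $S_i$ by Final-Add$(S_i\cup\{j\})$ and stop parsing for this $i$ (go to the next $i$). - Let $S(X)$ be the best of all feasible sets $S_i$ (those with $b(S_i)\le B$). Output the best of all the sets $S(X)$, $X\in E$. Subroutine Final-Add$(S)$: while $b(S)>B$, remove from $S$ an element $i$ with $b_i<\epsilon B$; end the loop if no such element exists. Return $S$.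
   Formalization: In (ii) Enumerate-Budget is corrected: S(X) is the best of X itself and the feasible sets S_i. With only the S_i the claim fails, e.g. three elements of cost 0.4B, f(S)=|S|, ε≤0.4, where the output has value 0 and OPT=2. The query bounds are stated for n≥2. *)

theory Defs
  imports
    Complex_Main
    "HOL-Library.Monad_Syntax"
    "HOL-Combinatorics.Multiset_Permutations"
begin

section \<open>Set functions and weak submodular orders\<close>

definition marginal :: "('a set \<Rightarrow> real) \<Rightarrow> 'a set \<Rightarrow> 'a set \<Rightarrow> real" where
  "marginal f X S = f (X \<union> S) - f S"

definition subadditive_on :: "'a set \<Rightarrow> ('a set \<Rightarrow> real) \<Rightarrow> bool" where
  "subadditive_on N f \<longleftrightarrow> (\<forall>A A'. A \<subseteq> N \<longrightarrow> A' \<subseteq> N \<longrightarrow> f (A \<union> A') \<le> f A + f A')"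

text \<open>A permutation of the ground set is a list \<open>\<pi>\<close> enumerating it without repetition.\<close>

definition pos :: "'a list \<Rightarrow> 'a \<Rightarrow> nat" where
  "pos \<pi> x = (THE i. i < length \<pi> \<and> \<pi> ! i = x)"

text \<open>
  \<open>Max (pos \<pi> ` A)\<close> and \<open>Min (pos \<pi> ` C)\<close> are the positions of the rightmost element of \<open>A\<close>
  and of the leftmost element of \<open>C\<close>; the comparison is vacuous if one of the sets is empty.
\<close>

definition precedes :: "'a list \<Rightarrow> 'a set \<Rightarrow> 'a set \<Rightarrow> bool" where
  "precedes \<pi> A C \<longleftrightarrow> A = {} \<or> C = {} \<or> Max (pos \<pi> ` A) < Min (pos \<pi> ` C)"

definition nested :: "'a list \<Rightarrow> 'a set \<Rightarrow> 'a set \<Rightarrow> bool" where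
  "nested \<pi> A' A \<longleftrightarrow> A' \<subseteq> A \<and> precedes \<pi> A' (A - A')"

definition weak_submodular_order :: "'a list \<Rightarrow> ('a set \<Rightarrow> real) \<Rightarrow> bool" where
  "weak_submodular_order \<pi> f \<longleftrightarrow>
     (\<forall>A' A C. A \<subseteq> set \<pi> \<longrightarrow> C \<subseteq> set \<pi> \<longrightarrow> nested \<pi> A' A \<longrightarrow> precedes \<pi> A C \<longrightarrow>
        marginal f C A \<le> marginal f C A')"

section \<open>Budgeted maximization\<close>

definition cost :: "('a \<Rightarrow> real) \<Rightarrow> 'a set \<Rightarrow> real" where
  "cost b S = (\<Sum>i\<in>S. b i)"

definition OPT :: "'a set \<Rightarrow> ('a set \<Rightarrow> real) \<Rightarrow> ('a \<Rightarrow> real) \<Rightarrow> real \<Rightarrow> real" where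
  "OPT N f b B = Max (f ` {S. S \<subseteq> N \<and> cost b S \<le> B})"

locale weak_order_budget =
  fixes N :: "'a set" and f :: "'a set \<Rightarrow> real" and \<pi> :: "'a list"
    and b :: "'a \<Rightarrow> real" and B :: real
  assumes finite_ground: "finite N"
    and f_empty: "f {} = 0"
    and monotone: "mono_on (Pow N) f"
    and subadditive: "subadditive_on N f"
    and permutation: "\<pi> \<in> permutations_of_set N"
    and order: "weak_submodular_order \<pi> f"
    and costs_pos: "\<And>i. i \<in> N \<Longrightarrow> b i > 0"
    and budget_pos: "B > 0"

section \<open>Nondeterministic algorithms with a value oracle\<close>

text \<open>
  An algorithm is a tree that does not mention the set function: it learns about it only through
  \<open>Query\<close> nodes, whose continuation receives the value of the queried set. \<open>Choose\<close> models
  unspecified choices (ties between best sets, the element removed next).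
\<close>

datatype ('a, 'r) oracle_alg =
    Return 'r
  | Query "'a set" "real \<Rightarrow> ('a, 'r) oracle_alg"
  | Choose "('a, 'r) oracle_alg list"

primrec bind_alg ::
  "('a, 'r) oracle_alg \<Rightarrow> ('r \<Rightarrow> ('a, 's) oracle_alg) \<Rightarrow> ('a, 's) oracle_alg" where
  "bind_alg (Return r) k = k r"
| "bind_alg (Query S g) k = Query S (\<lambda>v. bind_alg (g v) k)"
| "bind_alg (Choose ps) k = Choose (map (\<lambda>p. bind_alg p k) ps)"

adhoc_overloading Monad_Syntax.bind \<rightleftharpoons> bind_alg

text \<open>
  All pairs of a possible result and the number of oracle queries made on the way to it.
  The trees are well-founded, so every execution ends; it gets stuck only at \<open>Choose []\<close>.
\<close>

primrec outcomes :: "('a set \<Rightarrow> real) \<Rightarrow> ('a, 'r) oracle_alg \<Rightarrow> ('r \<times> nat) set" where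
  "outcomes f (Return r) = {(r, 0)}"
| "outcomes f (Query S g) = (\<lambda>(r, q). (r, Suc q)) ` outcomes f (g (f S))"
| "outcomes f (Choose ps) = \<Union> (set (map (outcomes f) ps))"

definition approximates ::
  "real \<Rightarrow> 'a set \<Rightarrow> ('a set \<Rightarrow> real) \<Rightarrow> ('a \<Rightarrow> real) \<Rightarrow> real \<Rightarrow> ('a, 'a set) oracle_alg \<Rightarrow> bool" where
  "approximates \<alpha> N f b B p \<longleftrightarrow>
     outcomes f p \<noteq> {} \<and>
     (\<forall>(S, q) \<in> outcomes f p. S \<subseteq> N \<and> cost b S \<le> B \<and> f S \<ge> \<alpha> * OPT N f b B)"

definition queries_bounded :: "('a set \<Rightarrow> real) \<Rightarrow> ('a, 'r) oracle_alg \<Rightarrow> real \<Rightarrow> bool" where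
  "queries_bounded f p c \<longleftrightarrow> (\<forall>(r, q) \<in> outcomes f p. real q \<le> c)"

definition query :: "'a set \<Rightarrow> ('a, real) oracle_alg" where
  "query S = Query S Return"

definition query_marginal :: "'a \<Rightarrow> 'a set \<Rightarrow> ('a, real) oracle_alg" where
  "query_marginal j S = do {u \<leftarrow> query ({j} \<union> S); v \<leftarrow> query S; Return (u - v)}"

fun map_alg :: "('b \<Rightarrow> ('a, 'c) oracle_alg) \<Rightarrow> 'b list \<Rightarrow> ('a, 'c list) oracle_alg" where
  "map_alg h [] = Return []"
| "map_alg h (x # xs) = do {y \<leftarrow> h x; ys \<leftarrow> map_alg h xs; Return (y # ys)}"

text \<open>Any set of largest value among the listed ones; the best of no sets is the empty set.\<close>

definition best :: "'a set list \<Rightarrow> ('a, 'a set) oracle_alg" where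
  "best Ss = do {
     vs \<leftarrow> map_alg query Ss;
     if Ss = [] then Return {}
     else Choose [Return S. (S, v) \<leftarrow> zip Ss vs, v = Max (set vs)]
   }"

text \<open>
  For an empty list of elements the result is an unspecified number divided by \<open>B\<close>; it is then
  never compared with anything, as there are no elements to parse.
\<close>

definition base_threshold :: "real \<Rightarrow> 'a list \<Rightarrow> ('a, real) oracle_alg" where
  "base_threshold B es = do {vs \<leftarrow> map_alg (\<lambda>e. query {e}) es; Return (Max (set vs) / B)}"

definition num_thresholds :: "real \<Rightarrow> nat \<Rightarrow> nat" where
  "num_thresholds \<epsilon> n = nat \<lceil>log (1 + \<epsilon>) (real n)\<rceil>"

section \<open>Threshold-Budget\<close>

fun threshold_parse ::
  "('a \<Rightarrow> real) \<Rightarrow> real \<Rightarrow> real \<Rightarrow> 'a set \<Rightarrow> 'a list \<Rightarrow> ('a, 'a set) oracle_alg" where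
  "threshold_parse b B t S [] = Return S"
| "threshold_parse b B t S (j # js) =
     (if cost b S < B then
        if b j < B - cost b S then do {
          m \<leftarrow> query_marginal j S;
          threshold_parse b B t (if m / b j \<ge> t then S \<union> {j} else S) js
        }
        else threshold_parse b B t S js
      else Return S)"

text \<open>The number of thresholds is computed from the size of the whole ground set.\<close>

definition threshold_budget ::
  "'a list \<Rightarrow> ('a \<Rightarrow> real) \<Rightarrow> real \<Rightarrow> real \<Rightarrow> ('a, 'a set) oracle_alg" where
  "threshold_budget \<pi> b B \<epsilon> = (
     let es = [e \<leftarrow> \<pi>. b e \<le> B] in do {
       \<tau> \<leftarrow> base_threshold B es;
       Ss \<leftarrow> map_alg (\<lambda>i. threshold_parse b B ((1 + \<epsilon>) ^ (i - 1) * \<tau>) {} es)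
               [1..<Suc (num_thresholds \<epsilon> (length \<pi>))];
       best (map (\<lambda>e. {e}) es @ Ss)
     })"

section \<open>Enumerate-Budget\<close>

text \<open>Here the sets under construction are represented by duplicate-free lists.\<close>

function final_add ::
  "('a \<Rightarrow> real) \<Rightarrow> real \<Rightarrow> real \<Rightarrow> 'a list \<Rightarrow> ('a, 'a set) oracle_alg" where
  "final_add b B \<epsilon> S =
     (if cost b (set S) > B \<and> (\<exists>i \<in> set S. b i < \<epsilon> * B)
      then Choose (map (\<lambda>i. final_add b B \<epsilon> (removeAll i S)) [i \<leftarrow> S. b i < \<epsilon> * B])
      else Return (set S))"
  by pat_completeness auto
termination
  by (relation "measure (\<lambda>(b, B, \<epsilon>, S). length S)") (auto intro: length_removeAll_less)

declare final_add.simps [simp del]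

fun enumerate_parse ::
  "('a \<Rightarrow> real) \<Rightarrow> real \<Rightarrow> real \<Rightarrow> real \<Rightarrow> 'a list \<Rightarrow> 'a list \<Rightarrow> ('a, 'a set) oracle_alg" where
  "enumerate_parse b B \<epsilon> t S [] = Return (set S)"
| "enumerate_parse b B \<epsilon> t S (j # js) =
     (if cost b (set S) < B then do {
        m \<leftarrow> query_marginal j (set S);
        if m / b j \<ge> t then
          if b j + cost b (set S) \<le> B then enumerate_parse b B \<epsilon> t (S @ [j]) js
          else final_add b B \<epsilon> (S @ [j])
        else enumerate_parse b B \<epsilon> t S js
      }
      else Return (set S))"

definition filtered :: "'a list \<Rightarrow> ('a \<Rightarrow> real) \<Rightarrow> 'a set \<Rightarrow> 'a list" where
  "filtered \<pi> b X = [e \<leftarrow> \<pi>. X = {} \<or> e \<in> X \<or> b e \<le> Min (b ` X)]"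

text \<open>
  The enumerated feasible set \<open>X\<close> is itself compared with the sets built from its filtered ground
  set. Without it the guarantee fails: for three elements of cost \<open>0.4 * B\<close> and \<open>f = card\<close>,
  every \<open>X\<close> of cost at most \<open>B\<close> leaves the ground set unfiltered, each threshold that admits an
  element overfills the budget, and for \<open>\<epsilon> \<le> 0.4\<close> nothing can be removed afterwards, so that no
  nonempty feasible set is ever built.
\<close>

definition enumerate_step ::
  "'a list \<Rightarrow> ('a \<Rightarrow> real) \<Rightarrow> real \<Rightarrow> real \<Rightarrow> 'a set \<Rightarrow> ('a, 'a set) oracle_alg" where
  "enumerate_step \<pi> b B \<epsilon> X = (
     let es = filtered \<pi> b X in do {
       \<tau> \<leftarrow> base_threshold B es;
       Ss \<leftarrow> map_alg (\<lambda>i. enumerate_parse b B \<epsilon> ((1 + \<epsilon>) ^ (i - 1) * \<tau>) [] es)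
               [1..<Suc (num_thresholds \<epsilon> (length es))];
       best (X # [S \<leftarrow> Ss. cost b S \<le> B])
     })"

definition enumerate_budget ::
  "'a list \<Rightarrow> ('a \<Rightarrow> real) \<Rightarrow> real \<Rightarrow> real \<Rightarrow> ('a, 'a set) oracle_alg" where
  "enumerate_budget \<pi> b B \<epsilon> = do {
     Ss \<leftarrow> map_alg (enumerate_step \<pi> b B \<epsilon>)
             [X \<leftarrow> map set (subseqs \<pi>). cost b X \<le> B \<and> real (card X) \<le> 1 / \<epsilon>];
     best Ss
   }"

end

theory Submission
  imports Defs
begin

text \<open>
  A weak submodular order gives just one inequality: if \<open>S\<close> lies to the left of \<open>x\<close> and \<open>C\<close> to
  the right of it, then \<open>C\<close> adds no more to \<open>insert x S\<close> than to \<open>S\<close> (\<open>diminishing\<close>). It is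
  always applied by peeling off the leftmost element of the part still to be parsed; comparisons
  of arbitrary nested sets, as for submodular functions, would be false. Three consequences carry
  the proof.

  First, an element \<open>j\<close> that was rejected because of \<open>f (insert j S) - f S < t * b j\<close>, for the set \<open>S\<close>
  built so far, is worth less than \<open>t * b j\<close> on top of the final set as well
  (\<open>rejected_element\<close>). Hence if all elements of an optimal set \<open>A\<close> were accepted or rejected on
  these grounds, the final set \<open>R\<close> satisfies \<open>f A \<le> f R + t * B\<close>. Second, after arbitrary
  deletions from a set built by accepting elements of density at least \<open>t\<close>, the elements left over
  are still worth \<open>t\<close> times their cost (\<open>retained_value_insert\<close>). Third, the losses caused by
  deleting single elements from \<open>A\<close> sum to at most \<open>f A\<close>, so that among \<open>K\<close> candidates some deletion
  loses at most \<open>f A / K\<close> (\<open>exists_dispensable_element\<close>).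

  By subadditivity the density \<open>f A / B\<close> is at most \<open>n\<close> times the lowest threshold. So a target
  density \<open>T\<close> that is a fixed fraction of \<open>f A / B\<close> either is reached by a singleton or has a
  threshold \<open>t\<close> with \<open>t \<le> T \<le> (1 + \<epsilon>) * t\<close> in the geometric grid (\<open>grid_threshold\<close>).

  Threshold-Budget takes \<open>T * B = 2 / 3 * f A\<close>. If some element dense enough to be accepted is left
  out for lack of budget, the set and this element are together worth \<open>t * B\<close>, so that the
  set or the singleton is worth half of it; otherwise the first consequence applies.

  Enumerate-Budget gains because after an overflow Final-Add retains cost \<open>(1 - \<epsilon>) * B\<close>, hence
  value \<open>(1 - \<epsilon>) * t * B\<close>, provided that it ends within the budget. This is certain if every
  element of cost at least \<open>\<epsilon> * B\<close> in the filtered ground set belongs to the feasible set \<open>X\<close>. Let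
  \<open>K = \<lfloor>1 / \<epsilon>\<rfloor>\<close>. If \<open>A\<close> has at most \<open>K\<close> elements, it is itself enumerated. Otherwise taking the
  \<open>K\<close> costliest elements of \<open>A\<close> for \<open>X\<close> would not do: the cheapest of them may cost more than
  \<open>\<epsilon> * B\<close> and let foreign elements of such cost through the filter. But the cheapest of the \<open>K + 1\<close>
  costliest elements costs less than \<open>\<epsilon> * B\<close>, so \<open>X\<close> consists of these \<open>K + 1\<close> elements without one
  of the \<open>K\<close> costlier ones, chosen by the third consequence (\<open>obtain_enumerated_guess\<close>). With
  \<open>T * B = (1 + \<epsilon>) / 2 * f A'\<close> for the remaining part \<open>A'\<close> of \<open>A\<close> one gets a set of value at least
  \<open>(1 - \<epsilon>) / 2 * f A'\<close>, and \<open>1 / K \<le> \<epsilon> / (1 - \<epsilon>)\<close> makes this \<open>(1 / 2 - \<epsilon>) * f A\<close>.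

  For the queries, a grid has \<open>O(log n / \<epsilon>)\<close> thresholds, each pass over the ground set makes two
  queries per element, and at most \<open>2 * n ^ K\<close> sets are enumerated.
\<close>

section \<open>Executions of oracle algorithms\<close>

text \<open>
  A Hoare-style judgement that bounds result and query count together, so that one pass over each
  algorithm settles both. The first conjunct says that the algorithm does not get stuck.
\<close>

definition ensures ::
  "('a set \<Rightarrow> real) \<Rightarrow> ('a, 'r) oracle_alg \<Rightarrow> nat \<Rightarrow> ('r \<Rightarrow> bool) \<Rightarrow> bool" where
  "ensures f p c Q \<longleftrightarrow> outcomes f p \<noteq> {} \<and> (\<forall>(r, q) \<in> outcomes f p. q \<le> c \<and> Q r)"

lemma outcomes_bind:
  "outcomes f (bind_alg p k) =
     {(s, q + q') |r q s q'. (r, q) \<in> outcomes f p \<and> (s, q') \<in> outcomes f (k r)}"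
proof (induction p)
  case (Query S g)
  show ?case
    by (simp add: Query.IH image_def) (force simp: Query.IH)
qed force+

lemma ensures_weaken:
  assumes "ensures f p c Q" "c \<le> c'" "\<And>r. Q r \<Longrightarrow> Q' r"
  shows "ensures f p c' Q'"
  using assms unfolding ensures_def by fastforce

lemma ensures_Return: "Q r \<Longrightarrow> ensures f (Return r) c Q"
  by (simp add: ensures_def)

lemma ensures_Choose:
  assumes "ps \<noteq> []" "\<And>p. p \<in> set ps \<Longrightarrow> ensures f p c Q"
  shows "ensures f (Choose ps) c Q"
proof -
  have "outcomes f (hd ps) \<noteq> {}" "hd ps \<in> set ps"
    using assms by (auto simp: ensures_def)
  then show ?thesis using assms(2) unfolding ensures_def by fastforce
qed

lemma ensures_bind:
  assumes p: "ensures f p c P" and k: "\<And>r. P r \<Longrightarrow> ensures f (k r) c' Q"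
  shows "ensures f (bind_alg p k) (c + c') Q"
proof -
  obtain r q where rq: "(r, q) \<in> outcomes f p" "P r"
    using p unfolding ensures_def by fastforce
  then obtain s q' where "(s, q') \<in> outcomes f (k r)"
    using k unfolding ensures_def by fastforce
  with rq(1) have "outcomes f (bind_alg p k) \<noteq> {}" unfolding outcomes_bind by blast
  moreover have "x + y \<le> c + c' \<and> Q s"
    if "(r, x) \<in> outcomes f p" "(s, y) \<in> outcomes f (k r)" for r s x y
  proof -
    have "x \<le> c" "P r" using p that(1) unfolding ensures_def by auto
    moreover have "y \<le> c' \<and> Q s" using k[OF \<open>P r\<close>] that(2) unfolding ensures_def by auto
    ultimately show ?thesis by simp
  qed
  ultimately show ?thesis unfolding ensures_def outcomes_bind by auto
qed

lemma ensures_query: "ensures f (query S) 1 (\<lambda>v. v = f S)"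
  by (simp add: ensures_def query_def)

lemma ensures_query_marginal:
  "ensures f (query_marginal j S) 2 (\<lambda>m. m = f (insert j S) - f S)"
  by (simp add: ensures_def query_marginal_def query_def)

lemma ensures_map_alg:
  assumes "\<And>x. x \<in> set xs \<Longrightarrow> ensures f (h x) c (P x)"
  shows "ensures f (map_alg h xs) (length xs * c) (list_all2 P xs)"
  using assms
proof (induction xs)
  case Nil
  then show ?case by (simp add: ensures_Return)
next
  case (Cons x xs)
  have "ensures f (map_alg h (x # xs)) (c + (length xs * c + 0)) (list_all2 P (x # xs))"
    unfolding map_alg.simps
    by (intro ensures_bind[where P = "P x"] ensures_bind[where P = "list_all2 P xs"]
        ensures_Return Cons) (auto simp: Cons.prems)
  then show ?case by simp
qed

lemma list_all2_in_set1:
  assumes "list_all2 P xs ys" "x \<in> set xs" obtains y where "y \<in> set ys" "P x y"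
  using assms by (metis in_set_conv_nth list_all2_conv_all_nth)

lemma list_all2_in_set2:
  assumes "list_all2 P xs ys" "y \<in> set ys" obtains x where "x \<in> set xs" "P x y"
  using assms by (metis in_set_conv_nth list_all2_conv_all_nth)

lemma ensures_map_query:
  "ensures f (map_alg (\<lambda>x. query (g x)) xs) (length xs) (\<lambda>vs. vs = map (\<lambda>x. f (g x)) xs)"
proof (rule ensures_weaken)
  show "ensures f (map_alg (\<lambda>x. query (g x)) xs) (length xs * 1)
      (list_all2 (\<lambda>x v. v = f (g x)) xs)"
    by (intro ensures_map_alg ensures_query)
qed (auto simp: list_all2_conv_all_nth intro: nth_equalityI)

lemma ensures_best:
  "ensures f (best Ss) (length Ss)
     (\<lambda>S. (if Ss = [] then S = {} else S \<in> set Ss) \<and> (\<forall>S' \<in> set Ss. f S' \<le> f S))"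
    (is "ensures f _ _ ?Q")
proof -
  have "ensures f (if Ss = [] then Return {}
          else Choose [Return S. (S, v) \<leftarrow> zip Ss vs, v = Max (set vs)]) 0 ?Q"
    if vs: "vs = map f Ss" for vs
  proof (cases "Ss = []")
    case False
    have eq: "zip Ss (map f Ss) = map (\<lambda>S. (S, f S)) Ss"
      by (induction Ss) auto
    have "Max (f ` set Ss) \<in> f ` set Ss" using False by simp
    then obtain S where "S \<in> set Ss" "f S = Max (f ` set Ss)" by auto
    then have "Return S \<in> set [Return S. (S, v) \<leftarrow> zip Ss vs, v = Max (set vs)]"
      unfolding vs eq by auto
    then have "[Return S. (S, v) \<leftarrow> zip Ss vs, v = Max (set vs)] \<noteq> []"
      by (metis empty_iff list.set(1))
    moreover have "ensures f p 0 ?Q"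
      if "p \<in> set [Return S. (S, v) \<leftarrow> zip Ss vs, v = Max (set vs)]" for p
      using that False unfolding vs eq
      by (auto intro!: ensures_Return split: if_splits)
    ultimately have "ensures f (Choose [Return S. (S, v) \<leftarrow> zip Ss vs, v = Max (set vs)]) 0 ?Q"
      by (rule ensures_Choose)
    then show ?thesis using False by simp
  qed (simp add: ensures_Return)
  then have "ensures f (best Ss) (length Ss + 0) ?Q"
    unfolding best_def using ensures_map_query[of f "\<lambda>x. x" Ss] by (intro ensures_bind)
  then show ?thesis by simp
qed

lemma ensures_base_threshold:
  "ensures f (base_threshold B es) (length es)
     (\<lambda>\<tau>. es \<noteq> [] \<longrightarrow> \<tau> = Max ((\<lambda>e. f {e}) ` set es) / B)"
proof -
  have "ensures f (base_threshold B es) (length es + 0)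
     (\<lambda>\<tau>. es \<noteq> [] \<longrightarrow> \<tau> = Max ((\<lambda>e. f {e}) ` set es) / B)"
    unfolding base_threshold_def
    by (rule ensures_bind[OF ensures_map_query]) (auto intro!: ensures_Return)
  then show ?thesis by simp
qed

section \<open>The geometric grid of thresholds\<close>

text \<open>
  The exponent is the least one whose power reaches \<open>T\<close>; it is positive as \<open>\<tau> < T\<close>, and the
  predecessor power is then the threshold just below \<open>T\<close>.
\<close>

lemma threshold_grid:
  assumes "\<epsilon> > 0" "\<tau> \<ge> 0" "\<tau> < T" "T \<le> real n * \<tau>"
  obtains i where "i \<in> set [1..<Suc (num_thresholds \<epsilon> n)]"
    "(1 + \<epsilon>) ^ (i - 1) * \<tau> \<le> T" "T \<le> (1 + \<epsilon>) * ((1 + \<epsilon>) ^ (i - 1) * \<tau>)"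
proof -
  let ?k = "num_thresholds \<epsilon> n"
  have n: "n > 0" using assms by (cases n) auto
  have "real n = (1 + \<epsilon>) powr log (1 + \<epsilon>) (real n)" using n assms by simp
  also have "\<dots> \<le> (1 + \<epsilon>) powr real ?k"
    using assms by (intro powr_mono) (auto simp: num_thresholds_def of_nat_ceiling)
  also have "\<dots> = (1 + \<epsilon>) ^ ?k" using assms by (simp add: powr_realpow)
  finally have top: "T \<le> (1 + \<epsilon>) ^ ?k * \<tau>"
    using assms by (meson mult_right_mono order_trans)
  define i where "i = (LEAST i. T \<le> (1 + \<epsilon>) ^ i * \<tau>)"
  have i: "T \<le> (1 + \<epsilon>) ^ i * \<tau>" unfolding i_def using top by (rule LeastI)
  have ik: "i \<le> ?k" unfolding i_def using top by (rule Least_le)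
  have i0: "i \<noteq> 0" using i assms by (intro notI) simp
  have "\<not> T \<le> (1 + \<epsilon>) ^ (i - 1) * \<tau>"
    using i0 not_less_Least[of "i - 1" "\<lambda>i. T \<le> (1 + \<epsilon>) ^ i * \<tau>"] unfolding i_def by simp
  moreover have "(1 + \<epsilon>) ^ i = (1 + \<epsilon>) * (1 + \<epsilon>) ^ (i - 1)" using i0 by (cases i) auto
  ultimately show thesis using i ik i0 by (intro that[of i]) auto
qed

lemma num_thresholds_le:
  assumes "0 < \<epsilon>" "\<epsilon> < 1" "m \<le> n" "n \<ge> 2"
  shows "real (num_thresholds \<epsilon> m) \<le> 4 * (ln (real n) / \<epsilon>)"
    and "1 \<le> 2 * (ln (real n) / \<epsilon>)"
proof -
  have "1/2 \<le> ln (2::real)" using exp_half_le2 by (subst ln_ge_iff) auto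
  also have "\<dots> \<le> ln (real n)" using assms by simp
  finally have ln: "1/2 \<le> ln (real n)" .
  then show one: "1 \<le> 2 * (ln (real n) / \<epsilon>)" using assms by (simp add: field_simps)
  \<comment> \<open>\<open>ln (1 + \<epsilon>) \<ge> \<epsilon> / (1 + \<epsilon>)\<close>, and \<open>1 + \<epsilon> \<le> 2\<close>\<close>
  have "ln (1 / (1 + \<epsilon>)) \<le> 1 / (1 + \<epsilon>) - 1"
    using assms by (intro ln_le_minus_one) auto
  then have "1 - 1 / (1 + \<epsilon>) \<le> ln (1 + \<epsilon>)" using assms by (simp add: ln_div)
  moreover have "\<epsilon> / 2 \<le> 1 - 1 / (1 + \<epsilon>)"
    using assms by (simp add: field_simps)
  ultimately have e: "\<epsilon> / 2 \<le> ln (1 + \<epsilon>)" by linarith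
  have "log (1 + \<epsilon>) (real m) \<le> 2 * (ln (real n) / \<epsilon>)"
  proof (cases "m = 0")
    case True
    then show ?thesis using one by (simp add: log_def)
  next
    case False
    have "log (1 + \<epsilon>) (real m) \<le> ln (real n) / ln (1 + \<epsilon>)"
      unfolding log_def using assms False by (intro divide_right_mono) auto
    also have "\<dots> \<le> ln (real n) / (\<epsilon> / 2)"
      using e assms ln by (intro divide_left_mono) auto
    finally show ?thesis by (simp add: field_simps)
  qed
  moreover have "real (num_thresholds \<epsilon> m) \<le> max 0 (log (1 + \<epsilon>) (real m) + 1)"
    unfolding num_thresholds_def by linarith
  ultimately show "real (num_thresholds \<epsilon> m) \<le> 4 * (ln (real n) / \<epsilon>)" using one by linarith
qed

lemma num_thresholds_mono:
  assumes "0 < \<epsilon>" "m \<le> n"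
  shows "num_thresholds \<epsilon> m \<le> num_thresholds \<epsilon> n"
proof (cases "m = 0")
  case True
  then show ?thesis by (simp add: num_thresholds_def log_def)
next
  case False
  then have "log (1 + \<epsilon>) (real m) \<le> log (1 + \<epsilon>) (real n)" using assms by simp
  then show ?thesis unfolding num_thresholds_def by (intro nat_mono ceiling_mono)
qed

section \<open>Weak submodular orders\<close>

lemma filter_eq_appendE:
  assumes "filter P xs = us @ vs"
  obtains us' vs' where "xs = us' @ vs'" "filter P us' = us" "filter P vs' = vs"
  using assms
proof (induction us arbitrary: xs thesis)
  case (Cons u us)
  from Cons.prems(2) obtain ys zs where xs: "xs = ys @ u # zs" "\<forall>y \<in> set ys. \<not> P y" "P u"
    and zs: "filter P zs = us @ vs"
    by (auto simp: filter_eq_Cons_iff)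
  obtain us' vs' where "zs = us' @ vs'" "filter P us' = us" "filter P vs' = vs"
    using Cons.IH[OF _ zs] by blast
  then show ?case using xs by (intro Cons.prems(1)[of "ys @ u # us'" vs']) auto
qed (metis append_Nil filter.simps(1))

lemma pos_append:
  assumes "distinct (us @ vs)"
  shows "x \<in> set us \<Longrightarrow> pos (us @ vs) x < length us"
    and "x \<in> set vs \<Longrightarrow> length us \<le> pos (us @ vs) x"
proof -
  have pos: "pos (us @ vs) ((us @ vs) ! i) = i" if "i < length (us @ vs)" for i
    unfolding pos_def using that assms nth_eq_iff_index_eq by blast
  show "pos (us @ vs) x < length us" if x: "x \<in> set us"
  proof -
    obtain i where "i < length us" "us ! i = x" using x by (auto simp: in_set_conv_nth)
    then show ?thesis using pos[of i] by (simp add: nth_append)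
  qed
  show "length us \<le> pos (us @ vs) x" if x: "x \<in> set vs"
  proof -
    obtain i where "i < length vs" "vs ! i = x" using x by (auto simp: in_set_conv_nth)
    then show ?thesis using pos[of "length us + i"] by (simp add: nth_append)
  qed
qed

lemma precedes_append:
  assumes "distinct (us @ vs)" "A \<subseteq> set us" "C \<subseteq> set vs"
  shows "precedes (us @ vs) A C"
proof (cases "A = {} \<or> C = {}")
  case False
  have fin: "finite A" "finite C" using assms finite_subset by auto
  have "Max (pos (us @ vs) ` A) < length us"
    using False fin assms pos_append(1)[OF assms(1)] by auto
  also have "length us \<le> Min (pos (us @ vs) ` C)"
    using False fin assms pos_append(2)[OF assms(1)] by auto
  finally show ?thesis by (simp add: precedes_def)
qed (auto simp: precedes_def)

context weak_order_budget
begin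

lemma set_permutation: "set \<pi> = N" and distinct_permutation: "distinct \<pi>"
  using permutation by (auto simp: permutations_of_set_def)

lemma length_permutation: "length \<pi> = card N"
  using distinct_card[OF distinct_permutation] set_permutation by simp

lemma f_mono: "A \<subseteq> A' \<Longrightarrow> A' \<subseteq> N \<Longrightarrow> f A \<le> f A'"
  using monotone by (auto simp: mono_on_def)

lemma f_nonneg: "A \<subseteq> N \<Longrightarrow> 0 \<le> f A"
  using f_mono[of "{}" A] f_empty by simp

lemma f_insert_le: "insert x A \<subseteq> N \<Longrightarrow> f (insert x A) \<le> f A + f {x}"
  using subadditive[unfolded subadditive_on_def, rule_format, of A "{x}"] by simp

lemma f_le_card_times:
  assumes "A \<subseteq> N" "\<And>e. e \<in> A \<Longrightarrow> f {e} \<le> M"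
  shows "f A \<le> real (card A) * M"
proof -
  have "finite A" using assms(1) finite_ground finite_subset by blast
  then show ?thesis using assms
  proof (induction A)
    case (insert x A)
    have "f (insert x A) \<le> f A + f {x}" using insert.prems by (intro f_insert_le)
    then show ?case using insert by (fastforce simp: algebra_simps)
  qed (simp add: f_empty)
qed

lemma cost_insert: "finite A \<Longrightarrow> x \<notin> A \<Longrightarrow> cost b (insert x A) = b x + cost b A"
  by (simp add: cost_def)

lemma cost_mono: "A \<subseteq> A' \<Longrightarrow> A' \<subseteq> N \<Longrightarrow> cost b A \<le> cost b A'"
  unfolding cost_def using costs_pos finite_ground finite_subset
  by (intro sum_mono2) (auto intro: less_imp_le)

lemma cost_member: "x \<in> A \<Longrightarrow> A \<subseteq> N \<Longrightarrow> b x \<le> cost b A"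
  using cost_mono[of "{x}" A] by (simp add: cost_def)

lemma optimum_attained:
  obtains A where "A \<subseteq> N" "cost b A \<le> B" "f A = OPT N f b B"
proof -
  let ?F = "{S. S \<subseteq> N \<and> cost b S \<le> B}"
  have "finite ?F" using finite_ground by simp
  moreover have "{} \<in> ?F" using budget_pos by (simp add: cost_def)
  ultimately have "Max (f ` ?F) \<in> f ` ?F" by (intro Max_in) auto
  then show thesis using that unfolding OPT_def by auto
qed

text \<open>
  The defining inequality for the nested pair \<open>S \<subseteq> insert x S\<close>, read off a list. Stating it for
  filtered lists covers the parsing of a ground set from which elements have been discarded.
\<close>

lemma diminishing:
  assumes es: "filter P \<pi> = us @ x # vs" and "S \<subseteq> set us" "C \<subseteq> set vs"
  shows "f (insert x S \<union> C) - f (insert x S) \<le> f (S \<union> C) - f S"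
proof -
  obtain us' zs where 1: "\<pi> = us' @ zs" "filter P us' = us" "filter P zs = x # vs"
    using filter_eq_appendE[OF es] by blast
  obtain ys vs' where 2: "zs = ys @ x # vs'" "filter P vs' = vs"
    using 1(3) by (auto simp: filter_eq_Cons_iff)
  define ws where "ws = us' @ ys"
  have \<pi>: "\<pi> = ws @ x # vs'" and S: "S \<subseteq> set ws" and C: "C \<subseteq> set vs'"
    using assms 1 2 by (auto simp: ws_def)
  have dist: "distinct (ws @ x # vs')" using distinct_permutation \<pi> by simp
  have "precedes \<pi> S (insert x S - S)"
    unfolding \<pi> by (rule precedes_append[OF dist S]) auto
  then have "nested \<pi> S (insert x S)" by (auto simp: nested_def)
  moreover have "precedes \<pi> (insert x S) C"
    using precedes_append[of "ws @ [x]" vs' "insert x S" C] dist S C \<pi> by auto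
  ultimately have "marginal f C (insert x S) \<le> marginal f C S"
    using order[unfolded weak_submodular_order_def, rule_format, of "insert x S" C S] S C
    by (auto simp: \<pi>)
  then show ?thesis by (simp add: marginal_def Un_commute)
qed

section \<open>Choosing a threshold\<close>

lemma base_threshold_nonneg:
  assumes "es \<noteq> []" "set es \<subseteq> N" "\<tau> = Max ((\<lambda>e. f {e}) ` set es) / B"
  shows "0 \<le> \<tau>"
proof -
  have "0 \<le> f {hd es}" "hd es \<in> set es" using assms by (auto intro!: f_nonneg)
  then have "0 \<le> Max ((\<lambda>e. f {e}) ` set es)"
    by (meson List.finite_set Max_ge finite_imageI imageI order_trans)
  then show ?thesis using assms(3) budget_pos by simp
qed

lemma thresholds_nonneg:
  assumes "set es \<subseteq> N" "0 < \<epsilon>" "es \<noteq> [] \<longrightarrow> \<tau> = Max ((\<lambda>e. f {e}) ` set es) / B"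
  shows "es = [] \<or> 0 \<le> (1 + \<epsilon>) ^ i * \<tau>"
proof (cases "es = []")
  case False
  then have "0 \<le> \<tau>" using base_threshold_nonneg assms by blast
  then show ?thesis using assms(2) by simp
qed simp

text \<open>
  Subadditivity bounds \<open>f A\<close> by \<open>m\<close> times the largest singleton value, which is \<open>\<tau> * B\<close>. So the grid
  of \<open>num_thresholds \<epsilon> m\<close> steps above \<open>\<tau>\<close> reaches every density \<open>T\<close> that is at most \<open>f A / B\<close>; it
  starts below \<open>T\<close> because no singleton is worth \<open>T * B\<close>.
\<close>

lemma grid_threshold:
  assumes "0 < \<epsilon>" "A \<noteq> {}" "A \<subseteq> set es" "set es \<subseteq> N" "card A \<le> m"
    and \<tau>: "\<tau> = Max ((\<lambda>e. f {e}) ` set es) / B"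
    and T: "T * B \<le> f A" "\<And>e. e \<in> set es \<Longrightarrow> f {e} < T * B"
  obtains i where "i \<in> set [1..<Suc (num_thresholds \<epsilon> m)]"
    "(1 + \<epsilon>) ^ (i - 1) * \<tau> * B \<le> T * B" "T * B \<le> (1 + \<epsilon>) * ((1 + \<epsilon>) ^ (i - 1) * \<tau> * B)"
proof -
  have "es \<noteq> []" using assms by auto
  have \<tau>0: "0 \<le> \<tau>" using \<open>es \<noteq> []\<close> assms(4) \<tau> by (rule base_threshold_nonneg)
  have \<tau>B: "\<tau> * B = Max ((\<lambda>e. f {e}) ` set es)" using \<tau> budget_pos by simp
  have "\<tau> * B < T * B" unfolding \<tau>B using \<open>es \<noteq> []\<close> T(2) by simp
  then have "\<tau> < T" using budget_pos by simp
  have "f A \<le> real (card A) * (\<tau> * B)"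
    using assms(3,4) by (intro f_le_card_times) (auto simp: \<tau>B)
  also have "\<dots> \<le> real m * (\<tau> * B)"
    using \<tau>0 budget_pos assms(5) by (intro mult_right_mono) auto
  finally have "T * B \<le> real m * \<tau> * B" using T(1) by simp
  then have "T \<le> real m * \<tau>" using budget_pos by simp
  from threshold_grid[OF assms(1) \<tau>0 \<open>\<tau> < T\<close> this] obtain i
    where "i \<in> set [1..<Suc (num_thresholds \<epsilon> m)]"
    "(1 + \<epsilon>) ^ (i - 1) * \<tau> \<le> T" "T \<le> (1 + \<epsilon>) * ((1 + \<epsilon>) ^ (i - 1) * \<tau>)" .
  then show thesis using that[of i] budget_pos by (simp flip: mult.assoc)
qed

section \<open>Threshold-Budget\<close>

text \<open>
  Here \<open>S\<close> is the set at the time when \<open>j\<close> is parsed and \<open>R\<close> the final set. All of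
  \<open>(R - S) \<union> (A - {j})\<close> comes after \<open>j\<close> and therefore gains no more on top of \<open>insert j S\<close> than on
  top of \<open>S\<close>; rearranged, adding \<open>j\<close> underneath it gains at most \<open>f (insert j S) - f S\<close>.
\<close>

lemma rejected_element:
  assumes es: "filter P \<pi> = us @ j # js" and "S \<subseteq> set us" "S \<subseteq> R" "R \<subseteq> S \<union> set js"
    and low: "f (insert j S) - f S < t * b j" and "t \<ge> 0"
    and later: "\<And>A. A \<subseteq> set js \<Longrightarrow> f (R \<union> A) \<le> f R + t * cost b A"
    and A: "A \<subseteq> set (j # js)"
  shows "f (R \<union> A) \<le> f R + t * cost b A"
proof (cases "j \<in> A")
  case True
  let ?A = "A - {j}"
  have eq: "insert j S \<union> ((R - S) \<union> ?A) = R \<union> A" "S \<union> ((R - S) \<union> ?A) = R \<union> ?A"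
    using assms True by auto
  have "f (R \<union> A) - f (insert j S) \<le> f (R \<union> ?A) - f S"
  proof -
    have "(R - S) \<union> ?A \<subseteq> set js" using assms by auto
    from diminishing[OF es \<open>S \<subseteq> set us\<close> this] show ?thesis unfolding eq by linarith
  qed
  also have "f (R \<union> ?A) \<le> f R + t * cost b ?A" using A by (intro later) auto
  finally have "f (R \<union> A) \<le> f R + t * (b j + cost b ?A)"
    using low by (simp add: algebra_simps)
  moreover have "finite A" using A finite_subset by auto
  then have "b j + cost b ?A = cost b A"
    using True unfolding cost_def by (simp add: sum.remove)
  ultimately show ?thesis by simp
qed (use A later in auto)

lemma accepted_element:
  assumes "j \<in> R" "t \<ge> 0" "A \<subseteq> set (j # js)" "set js \<subseteq> N" "b j > 0"
    and later: "\<And>A. A \<subseteq> set js \<Longrightarrow> f (R \<union> A) \<le> f R + t * cost b A"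
  shows "f (R \<union> A) \<le> f R + t * cost b A"
proof -
  have "R \<union> A = R \<union> (A - {j})" using assms by auto
  moreover have "A - {j} \<subseteq> set js" using assms by auto
  ultimately have "f (R \<union> A) \<le> f R + t * cost b (A - {j})" using later by metis
  also have "cost b (A - {j}) \<le> cost b A"
  proof -
    have "finite A" using assms(3) finite_subset by blast
    then show ?thesis unfolding cost_def using assms costs_pos
      by (intro sum_mono2) (auto intro: less_imp_le)
  qed
  finally show ?thesis using \<open>t \<ge> 0\<close> by (simp add: mult_left_mono)
qed

text \<open>
  The two alternatives are the two ways to lose elements of an optimal set. In the first one
  a sufficiently dense \<open>j\<close> does not fit; as \<open>S\<close> has density at least \<open>t\<close> too and \<open>insert j S\<close> costs
  at least \<open>B\<close>, subadditivity leaves \<open>t * B\<close> to be shared by \<open>R\<close> and \<open>{j}\<close>. An element that does not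
  fit but is not dense either counts as rejected for its density. The case \<open>js = []\<close> is kept apart
  because the threshold is unspecified on an empty ground set.
\<close>

lemma threshold_parse_ensures:
  assumes "filter P \<pi> = us @ js" "S \<subseteq> set us" "cost b S < B" "t * cost b S \<le> f S"
    and "js = [] \<or> t \<ge> 0"
  shows "ensures f (threshold_parse b B t S js) (2 * length js)
    (\<lambda>R. S \<subseteq> R \<and> R \<subseteq> S \<union> set js \<and> cost b R < B \<and>
         ((\<exists>j \<in> set js. t * B \<le> f R + f {j}) \<or>
          (\<forall>A \<subseteq> set js. f (R \<union> A) \<le> f R + t * cost b A)))"
  using assms
proof (induction js arbitrary: us S)
  case Nil
  then show ?case by (auto intro!: ensures_Return simp: cost_def)
next
  case (Cons j js)
  note es = Cons.prems(1)
  have "t \<ge> 0" using Cons.prems by simp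
  let ?Q = "\<lambda>S js R. S \<subseteq> R \<and> R \<subseteq> S \<union> set js \<and> cost b R < B \<and>
         ((\<exists>j \<in> set js. t * B \<le> f R + f {j}) \<or>
          (\<forall>A \<subseteq> set js. f (R \<union> A) \<le> f R + t * cost b A))"
  have inN: "set us \<union> set (j # js) \<subseteq> N"
    using es set_permutation by (metis filter_is_subset set_append)
  have "distinct (us @ j # js)"
    using es distinct_permutation by (metis distinct_filter)
  then have jS: "j \<notin> S" using Cons.prems(2) by auto
  have finS: "finite S" using Cons.prems(2) finite_subset by auto
  have es': "filter P \<pi> = (us @ [j]) @ js" using es by simp
  have skip: "ensures f (threshold_parse b B t S js) (2 * length js) (?Q S js)"
    using Cons.prems by (intro Cons.IH[OF es']) auto
  have reject: "?Q S (j # js) R" if Q: "?Q S js R" and low: "f (insert j S) - f S < t * b j" for R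
  proof (cases "\<exists>j \<in> set js. t * B \<le> f R + f {j}")
    case False
    then have "\<forall>A \<subseteq> set (j # js). f (R \<union> A) \<le> f R + t * cost b A"
      using rejected_element[OF es Cons.prems(2) _ _ low \<open>t \<ge> 0\<close>, of R] Q by blast
    then show ?thesis using Q by auto
  qed (use Q in auto)
  show ?case
  proof (cases "b j < B - cost b S")
    case False
    have "?Q S (j # js) R" if Q: "?Q S js R" for R
    proof (cases "f (insert j S) - f S < t * b j")
      case high: False
      have "t * B \<le> t * (cost b S + b j)"
        using False \<open>t \<ge> 0\<close> by (intro mult_left_mono) auto
      also have "\<dots> \<le> f (insert j S)" using high Cons.prems by (simp add: algebra_simps)
      also have "\<dots> \<le> f S + f {j}" using inN Cons.prems(2) by (intro f_insert_le) auto
      also have "f S \<le> f R"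
      proof (rule f_mono)
        show "S \<subseteq> R" using Q by simp
        have "R \<subseteq> S \<union> set js" using Q by simp
        then show "R \<subseteq> N" using inN Cons.prems(2) by auto
      qed
      finally show ?thesis using Q by auto
    qed (use reject Q in blast)
    then have "ensures f (threshold_parse b B t S js) (2 * length (j # js)) (?Q S (j # js))"
      by (rule ensures_weaken[OF skip, rotated]) simp_all
    then show ?thesis using False Cons.prems(3) by simp
  next
    case True
    have "ensures f (threshold_parse b B t (if m / b j \<ge> t then S \<union> {j} else S) js)
        (2 * length js) (?Q S (j # js))"
      if m: "m = f (insert j S) - f S" for m
    proof (cases "t \<le> m / b j")
      case high: True
      have bj: "b j > 0" using inN costs_pos by auto
      have c: "cost b (insert j S) = b j + cost b S" using finS jS by (rule cost_insert)
      have "t * b j \<le> f (insert j S) - f S" using high bj m by (simp add: field_simps)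
      then have rest: "ensures f (threshold_parse b B t (insert j S) js) (2 * length js)
          (?Q (insert j S) js)"
        using True Cons.prems by (intro Cons.IH[OF es']) (auto simp: c algebra_simps)
      have widen: "?Q S (j # js) R" if Q: "?Q (insert j S) js R" for R
      proof (cases "\<exists>j \<in> set js. t * B \<le> f R + f {j}")
        case False
        then have "\<forall>A \<subseteq> set (j # js). f (R \<union> A) \<le> f R + t * cost b A"
          using accepted_element[of j R t _ js] Q \<open>t \<ge> 0\<close> inN bj by auto
        then show ?thesis using Q by auto
      qed (use Q in auto)
      have "ensures f (threshold_parse b B t (insert j S) js) (2 * length js)
          (?Q S (j # js))"
        by (rule ensures_weaken[OF rest order_refl widen])
      then show ?thesis using high by simp
    next
      case False
      have "b j > 0" using inN costs_pos by auto
      then have low: "f (insert j S) - f S < t * b j" using False m by (simp add: field_simps)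
      have "ensures f (threshold_parse b B t S js) (2 * length js) (?Q S (j # js))"
        by (rule ensures_weaken[OF skip order_refl reject[OF _ low]])
      then show ?thesis using False by simp
    qed
    then have "ensures f (query_marginal j S \<bind>
          (\<lambda>m. threshold_parse b B t (if m / b j \<ge> t then S \<union> {j} else S) js))
        (2 + 2 * length js) (?Q S (j # js))"
      by (intro ensures_bind[OF ensures_query_marginal])
    then show ?thesis using True Cons.prems(3) by simp
  qed
qed


text \<open>
  The target \<open>2 / 3 * f A\<close> balances the alternatives of the parsing: half of it is \<open>1 / 3 * f A\<close>, and
  so is what it leaves of \<open>f A\<close>. The gap between \<open>t\<close> and the target costs the factor \<open>1 - \<epsilon>\<close>.
\<close>

lemma threshold_budget_ensures:
  assumes \<epsilon>: "0 < \<epsilon>" "\<epsilon> < 1"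
  defines "n \<equiv> card N" and "k \<equiv> num_thresholds \<epsilon> (card N)"
  shows "ensures f (threshold_budget \<pi> b B \<epsilon>) (2 * n + 2 * n * k + k)
    (\<lambda>S. S \<subseteq> N \<and> cost b S \<le> B \<and> (1 - \<epsilon>) / 3 * OPT N f b B \<le> f S)" (is "ensures f _ _ ?Q")
proof -
  define es where "es = filter (\<lambda>e. b e \<le> B) \<pi>"
  have esN: "set es \<subseteq> N" and len: "length es \<le> n"
    using set_permutation length_permutation by (auto simp: es_def n_def simp flip: length_permutation)
  define good where "good t R \<longleftrightarrow> R \<subseteq> set es \<and> cost b R < B \<and>
         ((\<exists>j \<in> set es. t * B \<le> f R + f {j}) \<or>
          (\<forall>A \<subseteq> set es. f (R \<union> A) \<le> f R + t * cost b A))" for t R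
  have parse: "ensures f (threshold_parse b B t {} es) (2 * length es) (good t)"
    if "es = [] \<or> t \<ge> 0" for t
    using that budget_pos f_empty
    by (intro ensures_weaken[OF threshold_parse_ensures[of "\<lambda>e. b e \<le> B" "[]" es "{}" t]])
      (auto simp: es_def good_def cost_def)
  have step: "?Q S" if \<tau>: "es \<noteq> [] \<longrightarrow> \<tau> = Max ((\<lambda>e. f {e}) ` set es) / B"
    and Ss: "list_all2 (\<lambda>i. good ((1 + \<epsilon>) ^ (i - 1) * \<tau>)) [1..<Suc k] Ss"
    and S: "if map (\<lambda>e. {e}) es @ Ss = [] then S = {} else S \<in> set (map (\<lambda>e. {e}) es @ Ss)"
    and best: "\<forall>S' \<in> set (map (\<lambda>e. {e}) es @ Ss). f S' \<le> f S" for S Ss \<tau>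
  proof -
    have "S \<subseteq> N \<and> cost b S \<le> B"
    proof -
      consider "S = {}" | e where "e \<in> set es" "S = {e}" | "S \<in> set Ss"
        using S by (auto split: if_splits)
      then show ?thesis
      proof cases
        case 3
        then obtain t where "good t S" using list_all2_in_set2[OF Ss] by metis
        then show ?thesis using esN by (auto simp: good_def)
      qed (use esN budget_pos in \<open>auto simp: es_def cost_def\<close>)
    qed
    then have feasible: "S \<subseteq> N" "cost b S \<le> B" by auto
    obtain A where A: "A \<subseteq> N" "cost b A \<le> B" "f A = OPT N f b B"
      using optimum_attained .
    have A_es: "A \<subseteq> set es"
      using A cost_member set_permutation by (fastforce simp: es_def)
    have single: "f {e} \<le> f S" if "e \<in> set es" for e using best that by simp
    have "(1 - \<epsilon>) / 3 * f A \<le> f S"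
    proof (cases "A = {}")
      case True
      then show ?thesis using f_nonneg[OF feasible(1)] by (simp add: f_empty)
    next
      case False
      then have "es \<noteq> []" using A_es by auto
      then have \<tau>': "\<tau> = Max ((\<lambda>e. f {e}) ` set es) / B" using \<tau> by simp
      have fA: "0 \<le> f A" by (rule f_nonneg[OF A(1)])
      define T where "T = 2 / 3 * f A / B"
      have TB: "T * B = 2 / 3 * f A" using budget_pos by (simp add: T_def)
      have e1: "(1 - \<epsilon>) / 3 * f A \<le> 1 / 3 * f A"
        using \<epsilon> fA by (intro mult_right_mono) auto
      show ?thesis
      proof (cases "\<exists>e \<in> set es. T * B \<le> f {e}")
        case True
        then obtain e where "e \<in> set es" "T * B \<le> f {e}" by auto
        then show ?thesis using single[of e] TB e1 fA by linarith
      next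
        case False
        have "card A \<le> card N" using A(1) finite_ground by (rule card_mono[rotated])
        moreover have "T * B \<le> f A" unfolding TB using fA by simp
        ultimately obtain i where i: "i \<in> set [1..<Suc k]"
          "(1 + \<epsilon>) ^ (i - 1) * \<tau> * B \<le> T * B" "T * B \<le> (1 + \<epsilon>) * ((1 + \<epsilon>) ^ (i - 1) * \<tau> * B)"
          using grid_threshold[OF \<epsilon>(1) \<open>A \<noteq> {}\<close> A_es esN _ \<tau>'] False unfolding k_def n_def
          by (metis not_le)
        define t where "t = (1 + \<epsilon>) ^ (i - 1) * \<tau>"
        have t0: "0 \<le> t"
          using base_threshold_nonneg[OF \<open>es \<noteq> []\<close> esN \<tau>'] \<epsilon> by (simp add: t_def)
        obtain R where R: "R \<in> set Ss" "good t R"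
          using list_all2_in_set1[OF Ss i(1)] unfolding t_def by metis
        have RS: "f R \<le> f S" using best R(1) by simp
        have t_up: "t * B \<le> 2 / 3 * f A" using i(2) TB by (simp add: t_def)
        have "(1 - \<epsilon>) * (2 / 3 * f A) \<le> (1 - \<epsilon>) * ((1 + \<epsilon>) * (t * B))"
          using i(3) \<epsilon> unfolding TB t_def by (intro mult_left_mono) auto
        also have "\<dots> = (1 - \<epsilon>\<^sup>2) * (t * B)" by (simp add: algebra_simps power2_eq_square)
        also have "\<dots> \<le> t * B"
          using t0 \<epsilon> budget_pos by (intro mult_left_le_one_le) (auto simp: power_le_one)
        finally have t_low: "(1 - \<epsilon>) / 3 * f A \<le> t * B / 2" by (simp add: field_simps)
        from R(2) consider j where "j \<in> set es" "t * B \<le> f R + f {j}"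
          | "f (R \<union> A) \<le> f R + t * cost b A"
          using A_es unfolding good_def by blast
        then show ?thesis
        proof cases
          case 1
          then show ?thesis using single[of j] RS t_low by linarith
        next
          case 2
          have "f A \<le> f (R \<union> A)" using R(2) A(1) esN by (intro f_mono) (auto simp: good_def)
          moreover have "t * cost b A \<le> t * B"
            using A(2) t0 by (rule mult_left_mono)
          ultimately show ?thesis using 2 t_up RS e1 by linarith
        qed
      qed
    qed
    then show ?thesis using feasible A(3) by simp
  qed
  have "ensures f (threshold_budget \<pi> b B \<epsilon>)
      (length es + (length [1..<Suc k] * (2 * length es) + (length es + k))) ?Q"
    unfolding threshold_budget_def Let_def length_permutation k_def[symmetric] es_def[symmetric]
  proof (rule ensures_bind[OF ensures_base_threshold])
    fix \<tau> assume \<tau>: "es \<noteq> [] \<longrightarrow> \<tau> = Max ((\<lambda>e. f {e}) ` set es) / B"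
    let ?t = "\<lambda>i. (1 + \<epsilon>) ^ (i - 1) * \<tau>"
    show "ensures f (map_alg (\<lambda>i. threshold_parse b B (?t i) {} es) [1..<Suc k] \<bind>
        (\<lambda>Ss. best (map (\<lambda>e. {e}) es @ Ss)))
      (length [1..<Suc k] * (2 * length es) + (length es + k)) ?Q"
    proof (rule ensures_bind)
      show "ensures f (map_alg (\<lambda>i. threshold_parse b B (?t i) {} es) [1..<Suc k])
          (length [1..<Suc k] * (2 * length es)) (list_all2 (\<lambda>i. good (?t i)) [1..<Suc k])"
        by (intro ensures_map_alg parse thresholds_nonneg[OF esN \<epsilon>(1) \<tau>])
      fix Ss assume Ss: "list_all2 (\<lambda>i. good (?t i)) [1..<Suc k] Ss"
      show "ensures f (best (map (\<lambda>e. {e}) es @ Ss)) (length es + k) ?Q"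
      proof (rule ensures_weaken[OF ensures_best])
        show "length (map (\<lambda>e. {e}) es @ Ss) \<le> length es + k"
          using list_all2_lengthD[OF Ss] unfolding length_append length_map length_upt by simp
      qed (use step[OF \<tau> Ss] in blast)
    qed
  qed
  moreover have "length es + (length [1..<Suc k] * (2 * length es) + (length es + k))
      \<le> 2 * n + 2 * n * k + k"
  proof -
    have "length [1..<Suc k] * (2 * length es) \<le> 2 * n * k"
      using mult_le_mono2[OF len, of k] unfolding length_upt by (simp add: algebra_simps)
    then show ?thesis using len by linarith
  qed
  ultimately show ?thesis by (rule ensures_weaken) auto
qed


end

section \<open>Enumerate-Budget\<close>

text \<open>
  Each removed element costs less than \<open>\<epsilon> * B\<close> and is removed only while the cost exceeds \<open>B\<close>, so
  the cost never drops to \<open>B - \<epsilon> * B\<close>, whatever elements are chosen.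
\<close>

lemma final_add_ensures:
  assumes "B - \<epsilon> * B < cost b (set S)"
  shows "ensures f (final_add b B \<epsilon> S) 0
    (\<lambda>R. R \<subseteq> set S \<and> B - \<epsilon> * B < cost b R \<and> (B < cost b R \<longrightarrow> (\<forall>i \<in> R. \<epsilon> * B \<le> b i)))"
  using assms
proof (induction b B \<epsilon> S rule: final_add.induct)
  case (1 b B \<epsilon> S)
  show ?case
  proof (cases "cost b (set S) > B \<and> (\<exists>i \<in> set S. b i < \<epsilon> * B)")
    case True
    have "ensures f (final_add b B \<epsilon> (removeAll i S)) 0 (\<lambda>R. R \<subseteq> set S \<and> B - \<epsilon> * B < cost b R \<and>
        (B < cost b R \<longrightarrow> (\<forall>i \<in> R. \<epsilon> * B \<le> b i)))"
      if i: "i \<in> set S" "b i < \<epsilon> * B" for i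
    proof -
      have "cost b (set S) = b i + cost b (set (removeAll i S))"
        using i(1) by (simp add: cost_def sum.remove)
      then have "B - \<epsilon> * B < cost b (set (removeAll i S))" using True i(2) by linarith
      with i show ?thesis by (intro ensures_weaken[OF 1(1)[OF True]]) auto
    qed
    then show ?thesis using True
      by (subst final_add.simps) (auto intro!: ensures_Choose simp: filter_empty_conv)
  next
    case False
    then show ?thesis using 1(2)
      by (subst final_add.simps) (force intro!: ensures_Return)
  qed
qed

context weak_order_budget
begin

text \<open>
  The inductive step for an invariant of the set \<open>S\<close> under construction: any part \<open>Q\<close> of it is worth
  \<open>t * cost b Q\<close>. Quantifying over all later sets \<open>C\<close>, and crediting \<open>Q\<close> with what \<open>C\<close> adds to \<open>S\<close>,
  is what makes the statement inductive: if \<open>j\<close> is retained it becomes part of \<open>C\<close>, and if it is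
  deleted the credit of \<open>C\<close> only decreases when \<open>S\<close> grows to \<open>insert j S\<close>. A comparison of the
  marginals of \<open>j\<close> over \<open>Q\<close> and over \<open>S\<close> is not available, because \<open>Q\<close> need not be an initial part
  of \<open>S\<close>.
\<close>

lemma retained_value_insert:
  assumes es: "filter P \<pi> = us @ j # js" and "S \<subseteq> set us"
    and old: "\<And>Q C. Q \<subseteq> S \<Longrightarrow> C \<subseteq> set (j # js) \<Longrightarrow> t * cost b Q + (f (S \<union> C) - f S) \<le> f (Q \<union> C)"
    and dense: "t * b j \<le> f (insert j S) - f S"
    and Q: "Q \<subseteq> insert j S" and C: "C \<subseteq> set js"
  shows "t * cost b Q + (f (insert j S \<union> C) - f (insert j S)) \<le> f (Q \<union> C)"
proof (cases "j \<in> Q")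
  case True
  let ?Q = "Q - {j}"
  have "finite Q" using Q assms(2) finite_subset by (metis List.finite_set finite.insertI)
  then have "cost b Q = b j + cost b ?Q" using True by (simp add: cost_def sum.remove)
  moreover have "t * cost b ?Q + (f (S \<union> insert j C) - f S) \<le> f (?Q \<union> insert j C)"
    using Q C by (intro old) auto
  moreover have "S \<union> insert j C = insert j S \<union> C" "?Q \<union> insert j C = Q \<union> C" using True by auto
  ultimately show ?thesis using dense by (simp add: distrib_left)
next
  case False
  have "t * cost b Q + (f (S \<union> C) - f S) \<le> f (Q \<union> C)" using False Q C by (intro old) auto
  then show ?thesis using diminishing[OF es assms(2) C] by linarith
qed

text \<open>
  An overflow, or a budget that is used up exactly, gives value \<open>t * ((1 - \<epsilon>) * B)\<close>; otherwise
  every element left out was rejected for its density. The last case is a Final-Add that stops above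
  the budget, which only happens if there are no cheap elements left.
\<close>

lemma enumerate_parse_ensures:
  assumes "filter P \<pi> = us @ js" "set S \<subseteq> set us" "cost b (set S) \<le> B" "\<epsilon> > 0"
    and "js = [] \<or> t \<ge> 0"
    and "\<And>Q C. Q \<subseteq> set S \<Longrightarrow> C \<subseteq> set js \<Longrightarrow>
           t * cost b Q + (f (set S \<union> C) - f (set S)) \<le> f (Q \<union> C)"
  shows "ensures f (enumerate_parse b B \<epsilon> t S js) (2 * length js)
    (\<lambda>R. R \<subseteq> set S \<union> set js \<and>
         (if cost b R \<le> B
          then t * ((1 - \<epsilon>) * B) \<le> f R \<or>
               set S \<subseteq> R \<and> (\<forall>A \<subseteq> set js. f (R \<union> A) \<le> f R + t * cost b A)
          else \<forall>i \<in> R. \<epsilon> * B \<le> b i))"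
  using assms
proof (induction js arbitrary: us S)
  case Nil
  then show ?case by (auto intro!: ensures_Return simp: cost_def)
next
  case (Cons j js)
  note es = Cons.prems(1) and US = Cons.prems(2) and retained = Cons.prems(6)
  let ?Q = "\<lambda>S js R. R \<subseteq> set S \<union> set js \<and>
         (if cost b R \<le> B
          then t * ((1 - \<epsilon>) * B) \<le> f R \<or>
               set S \<subseteq> R \<and> (\<forall>A \<subseteq> set js. f (R \<union> A) \<le> f R + t * cost b A)
          else \<forall>i \<in> R. \<epsilon> * B \<le> b i)"
  have "t \<ge> 0" using Cons.prems by simp
  have inN: "set us \<union> set (j # js) \<subseteq> N"
    using es set_permutation by (metis filter_is_subset set_append)
  then have bj: "b j > 0" using costs_pos by auto
  have "distinct (us @ j # js)"
    using es distinct_permutation by (metis distinct_filter)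
  then have jS: "j \<notin> set S" using US by auto
  have es': "filter P \<pi> = (us @ [j]) @ js" using es by simp
  show ?case
  proof (cases "cost b (set S) < B")
    case False
    then have "cost b (set S) = B" using Cons.prems(3) by simp
    then have "t * B \<le> f (set S)" using retained[of "set S" "{}"] by simp
    moreover have "t * ((1 - \<epsilon>) * B) \<le> t * B"
      using \<open>t \<ge> 0\<close> \<open>\<epsilon> > 0\<close> budget_pos by (intro mult_left_mono) auto
    ultimately show ?thesis using False Cons.prems(3) by (auto intro!: ensures_Return)
  next
    case True
    have "ensures f
        (if m / b j \<ge> t then
          if b j + cost b (set S) \<le> B then enumerate_parse b B \<epsilon> t (S @ [j]) js
          else final_add b B \<epsilon> (S @ [j])
        else enumerate_parse b B \<epsilon> t S js) (2 * length js) (?Q S (j # js))"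
      if m: "m = f (insert j (set S)) - f (set S)" for m
    proof (cases "t \<le> m / b j")
      case False
      then have low: "f (insert j (set S)) - f (set S) < t * b j"
        using m bj by (simp add: field_simps)
      have skip: "ensures f (enumerate_parse b B \<epsilon> t S js) (2 * length js) (?Q S js)"
      proof (rule Cons.IH[OF es'])
        show "t * cost b Q + (f (set S \<union> C) - f (set S)) \<le> f (Q \<union> C)"
          if "Q \<subseteq> set S" "C \<subseteq> set js" for Q C
          using that by (intro retained) auto
      qed (use Cons.prems in auto)
      have reject: "?Q S (j # js) R" if Q: "?Q S js R" for R
      proof (cases "cost b R \<le> B \<and> \<not> t * ((1 - \<epsilon>) * B) \<le> f R")
        case True
        then have "f (R \<union> A) \<le> f R + t * cost b A" if "A \<subseteq> set (j # js)" for A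
          using rejected_element[OF es US _ _ low \<open>t \<ge> 0\<close> _ that, of R] Q by auto
        then show ?thesis using Q True by auto
      qed (use Q in auto)
      have "ensures f (enumerate_parse b B \<epsilon> t S js) (2 * length js) (?Q S (j # js))"
        by (rule ensures_weaken[OF skip order_refl reject])
      then show ?thesis using False by simp
    next
      case high: True
      have dense: "t * b j \<le> f (insert j (set S)) - f (set S)"
        using high bj m by (simp add: field_simps)
      have retained': "t * cost b Q + (f (set (S @ [j]) \<union> C) - f (set (S @ [j]))) \<le> f (Q \<union> C)"
        if "Q \<subseteq> set (S @ [j])" "C \<subseteq> set js" for Q C
        using retained_value_insert[OF es US retained dense, of Q C] that by simp
      have c: "cost b (set (S @ [j])) = b j + cost b (set S)"
        using cost_insert[OF _ jS] by simp
      show ?thesis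
      proof (cases "b j + cost b (set S) \<le> B")
        case fits: True
        have rest: "ensures f (enumerate_parse b B \<epsilon> t (S @ [j]) js) (2 * length js)
            (?Q (S @ [j]) js)"
          using Cons.prems fits retained' c by (intro Cons.IH[OF es']) auto
        have widen: "?Q S (j # js) R" if Q: "?Q (S @ [j]) js R" for R
        proof (cases "cost b R \<le> B \<and> \<not> t * ((1 - \<epsilon>) * B) \<le> f R")
          case True
          then have "f (R \<union> A) \<le> f R + t * cost b A" if "A \<subseteq> set (j # js)" for A
            using accepted_element[OF _ \<open>t \<ge> 0\<close> that _ bj, of R] Q inN by auto
          then show ?thesis using Q True by auto
        qed (use Q in auto)
        have "ensures f (enumerate_parse b B \<epsilon> t (S @ [j]) js) (2 * length js) (?Q S (j # js))"
          by (rule ensures_weaken[OF rest order_refl widen])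
        then show ?thesis using high fits by simp
      next
        case overfull: False
        have "B - \<epsilon> * B < cost b (set (S @ [j]))"
          using overfull c \<open>\<epsilon> > 0\<close> budget_pos by (smt (verit) mult_pos_pos)
        note final = final_add_ensures[OF this, of f]
        have "ensures f (final_add b B \<epsilon> (S @ [j])) (2 * length js) (?Q S (j # js))"
        proof (rule ensures_weaken[OF final])
          fix R
          assume R: "R \<subseteq> set (S @ [j]) \<and> B - \<epsilon> * B < cost b R \<and>
            (B < cost b R \<longrightarrow> (\<forall>i \<in> R. \<epsilon> * B \<le> b i))"
          have "t * ((1 - \<epsilon>) * B) \<le> t * cost b R"
            using R \<open>t \<ge> 0\<close> by (intro mult_left_mono) (auto simp: algebra_simps)
          also have "\<dots> \<le> f R" using retained'[of R "{}"] R by simp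
          finally show "?Q S (j # js) R" using R by auto
        qed simp
        then show ?thesis using high overfull by simp
      qed
    qed
    then have "ensures f (query_marginal j (set S) \<bind> (\<lambda>m.
        if m / b j \<ge> t then
          if b j + cost b (set S) \<le> B then enumerate_parse b B \<epsilon> t (S @ [j]) js
          else final_add b B \<epsilon> (S @ [j])
        else enumerate_parse b B \<epsilon> t S js)) (2 + 2 * length js) (?Q S (j # js))"
      by (intro ensures_bind[OF ensures_query_marginal])
    then show ?thesis using True by simp
  qed
qed


text \<open>
  If all expensive elements of the filtered ground set are in \<open>X\<close>, an infeasible result of Final-Add
  would be a subset of the feasible set \<open>X\<close>. So every parse ends within the budget, and
  \<open>(1 + \<epsilon>) / 2 * f A\<close> is the target for which the two remaining cases give the same value. A
  singleton that reaches the target is left to the enumeration itself.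
\<close>

lemma enumerate_step_ensures:
  assumes \<epsilon>: "0 < \<epsilon>" "\<epsilon> < 1" and X: "X \<subseteq> N" "cost b X \<le> B"
  defines "n \<equiv> card N" and "k \<equiv> num_thresholds \<epsilon> (card N)" and "es \<equiv> filtered \<pi> b X"
  shows "ensures f (enumerate_step \<pi> b B \<epsilon> X) (n + 2 * n * k + k + 1)
    (\<lambda>S. S \<subseteq> N \<and> cost b S \<le> B \<and> f X \<le> f S \<and>
      (\<forall>A. A \<subseteq> set es \<longrightarrow> cost b A \<le> B \<longrightarrow> (\<forall>e \<in> set es. e \<in> X \<or> b e < \<epsilon> * B) \<longrightarrow>
        (\<forall>e \<in> set es. f {e} < (1 + \<epsilon>) / 2 * f A) \<longrightarrow> (1 - \<epsilon>) / 2 * f A \<le> f S))"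
    (is "ensures f _ _ ?Q")
proof -
  define k' where "k' = num_thresholds \<epsilon> (length es)"
  have esN: "set es \<subseteq> N" using set_permutation by (auto simp: es_def filtered_def)
  have "length es \<le> length \<pi>" unfolding es_def filtered_def by simp
  then have len: "length es \<le> n" by (simp add: n_def length_permutation)
  have k': "k' \<le> k" unfolding k'_def k_def
    using len \<epsilon>(1) by (intro num_thresholds_mono) (simp_all add: n_def)
  have dist: "distinct es" using distinct_permutation by (simp add: es_def filtered_def)
  define good where "good t R \<longleftrightarrow> R \<subseteq> set es \<and>
         (if cost b R \<le> B
          then t * ((1 - \<epsilon>) * B) \<le> f R \<or> (\<forall>A \<subseteq> set es. f (R \<union> A) \<le> f R + t * cost b A)
          else \<forall>i \<in> R. \<epsilon> * B \<le> b i)" for t R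
  have parse: "ensures f (enumerate_parse b B \<epsilon> t [] es) (2 * length es) (good t)"
    if "es = [] \<or> t \<ge> 0" for t
  proof (rule ensures_weaken[OF enumerate_parse_ensures order_refl])
    show "filter (\<lambda>e. X = {} \<or> e \<in> X \<or> b e \<le> Min (b ` X)) \<pi> = [] @ es"
      by (simp add: es_def filtered_def)
  qed (use that \<epsilon> budget_pos f_empty in \<open>auto simp: cost_def good_def split: if_splits\<close>)
  have step: "?Q S" if \<tau>: "es \<noteq> [] \<longrightarrow> \<tau> = Max ((\<lambda>e. f {e}) ` set es) / B"
    and Ss: "list_all2 (\<lambda>i. good ((1 + \<epsilon>) ^ (i - 1) * \<tau>)) [1..<Suc k'] Ss"
    and S: "S \<in> set (X # filter (\<lambda>S. cost b S \<le> B) Ss)"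
    and best: "\<forall>S' \<in> set (X # filter (\<lambda>S. cost b S \<le> B) Ss). f S' \<le> f S" for S Ss \<tau>
  proof -
    have feasible: "S \<subseteq> N \<and> cost b S \<le> B"
    proof (cases "S = X")
      case False
      then have "S \<in> set Ss" "cost b S \<le> B" using S by auto
      moreover obtain t where "good t S" using list_all2_in_set2[OF Ss \<open>S \<in> set Ss\<close>] by metis
      ultimately show ?thesis using esN by (auto simp: good_def)
    qed (use X in simp)
    have "(1 - \<epsilon>) / 2 * f A \<le> f S"
      if A: "A \<subseteq> set es" "cost b A \<le> B" and small: "\<forall>e \<in> set es. e \<in> X \<or> b e < \<epsilon> * B"
        and single: "\<forall>e \<in> set es. f {e} < (1 + \<epsilon>) / 2 * f A" for A
    proof (cases "A = {}")
      case True
      then show ?thesis using f_nonneg feasible by (simp add: f_empty)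
    next
      case False
      then have "es \<noteq> []" using A by auto
      then have \<tau>': "\<tau> = Max ((\<lambda>e. f {e}) ` set es) / B" using \<tau> by simp
      have fA: "0 \<le> f A" using A(1) esN by (intro f_nonneg) auto
      define T where "T = (1 + \<epsilon>) / 2 * f A / B"
      have TB: "T * B = (1 + \<epsilon>) / 2 * f A" using budget_pos by (simp add: T_def)
      have "(1 + \<epsilon>) / 2 * f A \<le> 1 * f A" using fA \<epsilon> by (intro mult_right_mono) auto
      then have T1: "T * B \<le> f A" using TB by simp
      have T2: "f {e} < T * B" if "e \<in> set es" for e unfolding TB using single that by blast
      have "card A \<le> length es"
        using A(1) dist by (metis List.finite_set card_mono distinct_card)
      then obtain i where i: "i \<in> set [1..<Suc k']"
          "(1 + \<epsilon>) ^ (i - 1) * \<tau> * B \<le> T * B" "T * B \<le> (1 + \<epsilon>) * ((1 + \<epsilon>) ^ (i - 1) * \<tau> * B)"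
        using grid_threshold[OF \<epsilon>(1) False A(1) esN _ \<tau>' T1 T2] unfolding k'_def by metis
      define t where "t = (1 + \<epsilon>) ^ (i - 1) * \<tau>"
      have t0: "0 \<le> t"
        using base_threshold_nonneg[OF \<open>es \<noteq> []\<close> esN \<tau>'] \<epsilon> by (simp add: t_def)
      have t_up: "t * B \<le> (1 + \<epsilon>) / 2 * f A" using i(2) TB by (simp add: t_def)
      have "(1 + \<epsilon>) * (f A / 2) \<le> (1 + \<epsilon>) * (t * B)" using i(3) TB by (simp add: t_def)
      then have t_low: "f A / 2 \<le> t * B" using \<epsilon> by simp
      obtain R where R: "R \<in> set Ss" "good t R"
        using list_all2_in_set1[OF Ss i(1)] unfolding t_def by metis
      have fits: "cost b R \<le> B"
      proof (rule ccontr)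
        assume over: "\<not> cost b R \<le> B"
        have "R \<subseteq> X"
        proof
          fix e assume "e \<in> R"
          then have "e \<in> set es" "\<epsilon> * B \<le> b e" using over R(2) by (auto simp: good_def)
          then show "e \<in> X" using small by (meson not_le)
        qed
        then have "cost b R \<le> cost b X" using X(1) by (rule cost_mono)
        then show False using over X(2) by simp
      qed
      have RS: "f R \<le> f S" using best R(1) fits by simp
      from R(2) fits consider "t * ((1 - \<epsilon>) * B) \<le> f R" | "f (R \<union> A) \<le> f R + t * cost b A"
        using A(1) unfolding good_def by auto
      then show ?thesis
      proof cases
        case 1
        have "(1 - \<epsilon>) * (f A / 2) \<le> (1 - \<epsilon>) * (t * B)"
          using t_low \<epsilon> by (intro mult_left_mono) auto
        also have "\<dots> = t * ((1 - \<epsilon>) * B)" by simp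
        finally show ?thesis using 1 RS by simp
      next
        case 2
        have "f A \<le> f (R \<union> A)" using R(2) A(1) esN by (intro f_mono) (auto simp: good_def)
        moreover have "t * cost b A \<le> t * B" using A(2) t0 by (rule mult_left_mono)
        ultimately have "f A - (1 + \<epsilon>) / 2 * f A \<le> f S" using 2 t_up RS by linarith
        then show ?thesis by (simp add: field_simps)
      qed
    qed
    then show ?thesis using feasible best by auto
  qed
  have "ensures f (enumerate_step \<pi> b B \<epsilon> X)
      (length es + (length [1..<Suc k'] * (2 * length es) + (1 + k'))) ?Q"
    unfolding enumerate_step_def Let_def es_def[symmetric] k'_def[symmetric]
  proof (rule ensures_bind[OF ensures_base_threshold])
    fix \<tau> assume \<tau>: "es \<noteq> [] \<longrightarrow> \<tau> = Max ((\<lambda>e. f {e}) ` set es) / B"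
    let ?t = "\<lambda>i. (1 + \<epsilon>) ^ (i - 1) * \<tau>"
    show "ensures f (map_alg (\<lambda>i. enumerate_parse b B \<epsilon> (?t i) [] es) [1..<Suc k'] \<bind>
        (\<lambda>Ss. best (X # filter (\<lambda>S. cost b S \<le> B) Ss)))
      (length [1..<Suc k'] * (2 * length es) + (1 + k')) ?Q"
    proof (rule ensures_bind)
      show "ensures f (map_alg (\<lambda>i. enumerate_parse b B \<epsilon> (?t i) [] es) [1..<Suc k'])
          (length [1..<Suc k'] * (2 * length es)) (list_all2 (\<lambda>i. good (?t i)) [1..<Suc k'])"
        by (intro ensures_map_alg parse thresholds_nonneg[OF esN \<epsilon>(1) \<tau>])
      fix Ss assume Ss: "list_all2 (\<lambda>i. good (?t i)) [1..<Suc k'] Ss"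
      show "ensures f (best (X # filter (\<lambda>S. cost b S \<le> B) Ss)) (1 + k') ?Q"
      proof (rule ensures_weaken[OF ensures_best])
        have "length (filter (\<lambda>S. cost b S \<le> B) Ss) \<le> length Ss" by simp
        then show "length (X # filter (\<lambda>S. cost b S \<le> B) Ss) \<le> 1 + k'"
          using list_all2_lengthD[OF Ss] unfolding length_Cons length_upt by simp
        fix S
        assume S: "(if X # filter (\<lambda>S. cost b S \<le> B) Ss = [] then S = {}
            else S \<in> set (X # filter (\<lambda>S. cost b S \<le> B) Ss)) \<and>
          (\<forall>S' \<in> set (X # filter (\<lambda>S. cost b S \<le> B) Ss). f S' \<le> f S)"
        show "?Q S" by (rule step[OF \<tau> Ss]) (use S in simp_all)
      qed
    qed
  qed
  moreover have "length es + (length [1..<Suc k'] * (2 * length es) + (1 + k'))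
      \<le> n + 2 * n * k + k + 1"
  proof -
    have "k' * length es \<le> k * n" using len k' by (rule mult_le_mono[rotated])
    then have "length [1..<Suc k'] * (2 * length es) \<le> 2 * n * k"
      unfolding length_upt by (simp add: algebra_simps)
    then show ?thesis using len k' by linarith
  qed
  ultimately show ?thesis by (rule ensures_weaken) auto
qed

text \<open>
  Deleting \<open>y\<close> loses at most the gain of \<open>y\<close> over the elements of \<open>A\<close> to its left, since the
  elements to its right gain no less without \<open>y\<close>. These gains telescope to \<open>f A\<close>, and the smallest
  loss is at most the average.
\<close>

lemma exists_dispensable_element:
  assumes A: "A \<subseteq> N" and Y: "Y \<subseteq> A" "Y \<noteq> {}"
  obtains y where "y \<in> Y" "real (card Y) * (f A - f (A - {y})) \<le> f A"
proof -
  have fin: "finite Y" using A Y finite_ground finite_subset by metis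
  \<comment> \<open>the telescoping sum, along initial parts of the order\<close>
  have prefix: "(\<Sum>y \<in> Y \<inter> set us. f A - f (A - {y})) \<le> f (A \<inter> set us)" if "\<pi> = us @ vs" for us vs
    using that
  proof (induction us arbitrary: vs rule: rev_induct)
    case Nil
    then show ?case by (simp add: f_empty)
  next
    case (snoc x us)
    have \<pi>: "\<pi> = us @ x # vs" using snoc.prems by simp
    note IH = snoc.IH[OF \<pi>]
    show ?case
    proof (cases "x \<in> Y")
      case False
      have "f (A \<inter> set us) \<le> f (A \<inter> set (us @ [x]))" using A by (intro f_mono) auto
      then show ?thesis using IH False by simp
    next
      case True
      let ?S = "A \<inter> set us" and ?C = "A \<inter> set vs"
      have x: "x \<notin> set us" "x \<notin> set vs" using distinct_permutation \<pi> by auto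
      have "A \<subseteq> set \<pi>" using A set_permutation by simp
      then have eq: "insert x ?S \<union> ?C = A" "?S \<union> ?C = A - {x}" "A \<inter> set (us @ [x]) = insert x ?S"
        using True Y x unfolding \<pi> by auto
      have "f A - f (insert x ?S) \<le> f (A - {x}) - f ?S"
        using diminishing[of "\<lambda>_. True" us x vs ?S ?C] \<pi> unfolding eq by simp
      moreover have "Y \<inter> set (us @ [x]) = insert x (Y \<inter> set us)" using True by auto
      ultimately show ?thesis using IH x fin unfolding eq by simp
    qed
  qed
  have "Y \<inter> set \<pi> = Y" "A \<inter> set \<pi> = A" using A Y set_permutation by auto
  then have total: "(\<Sum>y \<in> Y. f A - f (A - {y})) \<le> f A" using prefix[of \<pi> "[]"] by simp
  have "\<exists>y \<in> Y. real (card Y) * (f A - f (A - {y})) \<le> f A"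
  proof (rule ccontr)
    assume "\<not> ?thesis"
    then have "f A < real (card Y) * (f A - f (A - {y}))" if "y \<in> Y" for y
      using that by (meson not_le)
    then have "(\<Sum>y \<in> Y. f A) < (\<Sum>y \<in> Y. real (card Y) * (f A - f (A - {y})))"
      using fin Y(2) by (intro sum_strict_mono) auto
    also have "\<dots> = real (card Y) * (\<Sum>y \<in> Y. f A - f (A - {y}))" by (simp add: sum_distrib_left)
    also have "\<dots> \<le> real (card Y) * f A" using total by (intro mult_left_mono) auto
    finally show False by simp
  qed
  then show thesis using that by blast
qed

end

lemma obtain_largest_subset:
  fixes g :: "'a \<Rightarrow> real"
  assumes "finite A" "m \<le> card A"
  obtains Y where "Y \<subseteq> A" "card Y = m" "\<And>y a. y \<in> Y \<Longrightarrow> a \<in> A - Y \<Longrightarrow> g a \<le> g y"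
  using assms(2)
proof (induction m arbitrary: thesis)
  case 0
  then show ?case by (metis card.empty empty_iff empty_subsetI)
next
  case (Suc m)
  from Suc.prems(2) have "m \<le> card A" by simp
  with Suc.IH obtain Y where Y: "Y \<subseteq> A" "card Y = m"
    "\<And>y a. y \<in> Y \<Longrightarrow> a \<in> A - Y \<Longrightarrow> g a \<le> g y" by blast
  have fin: "finite (A - Y)" "finite Y" using assms(1) Y(1) finite_subset by auto
  have "Y \<noteq> A" using Y(2) Suc.prems(2) by auto
  then have ne: "A - Y \<noteq> {}" using Y(1) by auto
  then have "Max (g ` (A - Y)) \<in> g ` (A - Y)" using fin by (intro Max_in) auto
  then obtain z where z: "z \<in> A - Y" "g z = Max (g ` (A - Y))" by auto
  show ?case
  proof (rule Suc.prems(1))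
    show "insert z Y \<subseteq> A" using z Y by auto
    show "card (insert z Y) = Suc m" using z Y fin by simp
    fix y a assume "y \<in> insert z Y" "a \<in> A - insert z Y"
    then show "g a \<le> g y" using Y(3) z(2) fin(1) by (cases "y = z") auto
  qed
qed

lemma card_small_subsets_le:
  assumes "finite N" "card N \<ge> 2"
  shows "card {X. X \<subseteq> N \<and> card X \<le> K} \<le> 2 * card N ^ K"
proof -
  let ?n = "card N"
  have "{X. X \<subseteq> N \<and> card X \<le> K} = (\<Union>k\<le>K. {X. X \<subseteq> N \<and> card X = k})" by auto
  then have "card {X. X \<subseteq> N \<and> card X \<le> K} \<le> (\<Sum>k\<le>K. card {X. X \<subseteq> N \<and> card X = k})"
    using card_UN_le[of "{..K}" "\<lambda>k. {X. X \<subseteq> N \<and> card X = k}"] by simp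
  also have "\<dots> \<le> (\<Sum>k\<le>K. ?n ^ k)"
  proof (rule sum_mono)
    fix k
    show "card {X. X \<subseteq> N \<and> card X = k} \<le> ?n ^ k"
      using n_subsets[OF assms(1), of k] binomial_le_pow[of k ?n]
      by (cases "k \<le> ?n") (auto simp: binomial_eq_0)
  qed
  also have "\<dots> \<le> 2 * ?n ^ K"
  proof (induction K)
    case (Suc K)
    have "2 * ?n ^ K \<le> ?n * ?n ^ K" using assms(2) by (intro mult_right_mono) auto
    then show ?case using Suc unfolding sum.atMost_Suc power_Suc by linarith
  qed simp
  finally show ?thesis .
qed

context weak_order_budget
begin

text \<open>
  Of the \<open>K + 1\<close> costliest elements of \<open>A\<close> the cheapest one, \<open>s\<close>, costs at most \<open>B / (K + 1)\<close>, which
  is less than \<open>\<epsilon> * B\<close>. It stays in \<open>X\<close> and becomes the bar for the filter: all elements of \<open>A\<close>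
  outside \<open>X\<close> other than the dropped \<open>o'\<close> pass, and whatever passes from outside \<open>X\<close> is cheap.
\<close>

lemma obtain_enumerated_guess:
  assumes A: "A \<subseteq> N" "cost b A \<le> B" and "\<epsilon> > 0" "K > 0" and K: "1 / \<epsilon> < real K + 1" "K < card A"
  obtains o' X where "o' \<in> A" "X \<subseteq> A" "card X = K" "A - {o'} \<subseteq> set (filtered \<pi> b X)"
    "\<And>e. e \<in> set (filtered \<pi> b X) \<Longrightarrow> e \<in> X \<or> b e < \<epsilon> * B"
    "real K * (f A - f (A - {o'})) \<le> f A"
proof -
  have finA: "finite A" using A(1) finite_ground finite_subset by metis
  obtain Y where Y: "Y \<subseteq> A" "card Y = Suc K" "\<And>y a. y \<in> Y \<Longrightarrow> a \<in> A - Y \<Longrightarrow> b a \<le> b y"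
    using obtain_largest_subset[OF finA, of "Suc K" b] K(2) by (metis Suc_leI)
  have finY: "finite Y" using Y(1) finA finite_subset by metis
  have "Min (b ` Y) \<in> b ` Y" using Y(2) finY by (intro Min_in) auto
  then obtain s where s: "s \<in> Y" "b s = Min (b ` Y)" by auto
  then have s_le: "b s \<le> b y" if "y \<in> Y" for y using that finY by simp
  have cardYs: "card (Y - {s}) = K" using Y(2) s(1) finY by simp
  have "real (Suc K) * b s \<le> cost b Y"
    unfolding cost_def using sum_bounded_below[of Y "b s" b] s_le Y(2) by simp
  also have "\<dots> \<le> B" using cost_mono[OF Y(1) A(1)] A(2) by simp
  finally have "(real K + 1) * b s \<le> B" by (simp add: algebra_simps)
  moreover have "b s > 0" using s(1) Y(1) A(1) costs_pos by auto
  then have "1 / \<epsilon> * b s < (real K + 1) * b s" using K(1) by (intro mult_strict_right_mono)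
  ultimately have "b s / \<epsilon> < B" by simp
  then have s_small: "b s < \<epsilon> * B" using \<open>\<epsilon> > 0\<close> by (simp add: field_simps)
  obtain o' where o': "o' \<in> Y - {s}" "real K * (f A - f (A - {o'})) \<le> f A"
    using exists_dispensable_element[OF A(1), of "Y - {s}"] Y(1) cardYs \<open>K > 0\<close>
    by (metis Diff_subset card.empty less_irrefl order_trans)
  define X where "X = Y - {o'}"
  have sX: "s \<in> X" using s(1) o'(1) by (auto simp: X_def)
  have "Min (b ` X) = b s"
    using sX finY s_le by (intro Min_eqI) (auto simp: X_def)
  then have es: "set (filtered \<pi> b X) = {e \<in> N. e \<in> X \<or> b e \<le> b s}"
    using sX set_permutation by (auto simp: filtered_def)
  show thesis
  proof (rule that)
    show "o' \<in> A" "X \<subseteq> A" using o'(1) Y(1) by (auto simp: X_def)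
    show "card X = K" using o'(1) Y(2) finY by (simp add: X_def)
    show "A - {o'} \<subseteq> set (filtered \<pi> b X)"
      unfolding es using A(1) Y(3)[OF s(1)] by (auto simp: X_def)
    show "e \<in> X \<or> b e < \<epsilon> * B" if "e \<in> set (filtered \<pi> b X)" for e
      using that s_small unfolding es by auto
  qed (rule o'(2))
qed

text \<open>
  The passage from \<open>A\<close> to \<open>A - {o'}\<close> costs the share \<open>1 / K\<close>, and \<open>K > 1 / \<epsilon> - 1\<close> means that
  \<open>(1 - \<epsilon>) * (1 - 1 / K) \<ge> 1 - 2 * \<epsilon>\<close>.
\<close>

lemma enumerate_budget_ensures:
  assumes \<epsilon>: "0 < \<epsilon>" "\<epsilon> < 1 / 2"
  defines "n \<equiv> card N" and "k \<equiv> num_thresholds \<epsilon> (card N)" and "K \<equiv> nat \<lfloor>1 / \<epsilon>\<rfloor>"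
  shows "ensures f (enumerate_budget \<pi> b B \<epsilon>)
    (card {X. X \<subseteq> N \<and> card X \<le> K} * (n + 2 * n * k + k + 2))
    (\<lambda>S. S \<subseteq> N \<and> cost b S \<le> B \<and> (1 / 2 - \<epsilon>) * OPT N f b B \<le> f S)" (is "ensures f _ _ ?Q")
proof -
  have Kiff: "real m \<le> 1 / \<epsilon> \<longleftrightarrow> m \<le> K" for m
    unfolding K_def using \<epsilon> by (simp add: le_nat_iff le_floor_iff)
  have K1: "1 / \<epsilon> < real K + 1" using Kiff[of "Suc K"] by simp
  have K2: "K \<ge> 2" using Kiff[of 2] \<epsilon> by (simp add: field_simps)
  define E where "E = filter (\<lambda>X. cost b X \<le> B \<and> real (card X) \<le> 1 / \<epsilon>) (map set (subseqs \<pi>))"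
  have "set (map set (subseqs \<pi>)) = Pow N" using subseqs_powset[of \<pi>] set_permutation by simp
  then have setE: "set E = {X. X \<subseteq> N \<and> cost b X \<le> B \<and> card X \<le> K}" unfolding E_def Kiff by auto
  have "distinct E"
    unfolding E_def using distinct_set_subseqs[OF distinct_permutation] by (rule distinct_filter)
  then have "length E = card (set E)" by (simp add: distinct_card)
  also have "\<dots> \<le> card {X. X \<subseteq> N \<and> card X \<le> K}"
    unfolding setE using finite_ground by (intro card_mono) auto
  finally have lenE: "length E \<le> card {X. X \<subseteq> N \<and> card X \<le> K}" .
  have "{} \<in> set E" unfolding setE using budget_pos by (simp add: cost_def)
  then have E_ne: "E \<noteq> []" by auto
  \<comment> \<open>what the processing of an enumerated set \<open>X\<close> guarantees for its result \<open>S\<close>\<close>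
  define good where "good X S \<longleftrightarrow> S \<subseteq> N \<and> cost b S \<le> B \<and> f X \<le> f S \<and>
      (\<forall>A. A \<subseteq> set (filtered \<pi> b X) \<longrightarrow> cost b A \<le> B \<longrightarrow>
        (\<forall>e \<in> set (filtered \<pi> b X). e \<in> X \<or> b e < \<epsilon> * B) \<longrightarrow>
        (\<forall>e \<in> set (filtered \<pi> b X). f {e} < (1 + \<epsilon>) / 2 * f A) \<longrightarrow> (1 - \<epsilon>) / 2 * f A \<le> f S)"
    for X S
  have steps: "ensures f (map_alg (enumerate_step \<pi> b B \<epsilon>) E)
      (length E * (n + 2 * n * k + k + 1)) (list_all2 good E)"
  proof (rule ensures_map_alg)
    fix X assume "X \<in> set E"
    then show "ensures f (enumerate_step \<pi> b B \<epsilon> X) (n + 2 * n * k + k + 1) (good X)"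
      using enumerate_step_ensures[of \<epsilon> X] \<epsilon> unfolding setE good_def n_def k_def by simp
  qed
  have outcome: "?Q S" if Ss: "list_all2 good E Ss" and S: "S \<in> set Ss"
    and best: "\<forall>S' \<in> set Ss. f S' \<le> f S" for Ss S
  proof -
    have feasible: "S \<subseteq> N" "cost b S \<le> B"
      using list_all2_in_set2[OF Ss S] unfolding good_def by metis+
    have good: "\<exists>S'. good X S' \<and> f S' \<le> f S" if "X \<in> set E" for X
      using list_all2_in_set1[OF Ss that] best by metis
    have guess: "f X \<le> f S" if "X \<in> set E" for X
      using good[OF that] unfolding good_def by force
    obtain A where A: "A \<subseteq> N" "cost b A \<le> B" "f A = OPT N f b B" using optimum_attained .
    have fA: "0 \<le> f A" by (rule f_nonneg[OF A(1)])
    have "(1 / 2 - \<epsilon>) * f A \<le> f S"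
    proof (cases "card A \<le> K")
      case True
      then have "f A \<le> f S" using A by (intro guess) (simp add: setE)
      moreover have "(1 / 2 - \<epsilon>) * f A \<le> 1 * f A" using fA \<epsilon> by (intro mult_right_mono) auto
      ultimately show ?thesis by simp
    next
      case False
      obtain o' X where X: "o' \<in> A" "X \<subseteq> A" "card X = K" "A - {o'} \<subseteq> set (filtered \<pi> b X)"
        "\<And>e. e \<in> set (filtered \<pi> b X) \<Longrightarrow> e \<in> X \<or> b e < \<epsilon> * B"
        "real K * (f A - f (A - {o'})) \<le> f A"
        by (rule obtain_enumerated_guess[OF A(1,2) \<epsilon>(1) _ K1]) (use K2 False in auto)
      let ?A = "A - {o'}"
      have costX: "cost b X \<le> B" using cost_mono[OF X(2) A(1)] A(2) by simp
      have cost': "cost b ?A \<le> B" using cost_mono[of ?A A] A by force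
      have XE: "X \<in> set E" using X(2,3) A(1) costX by (auto simp: setE)
      have "(1 - \<epsilon>) / 2 * f ?A \<le> f S"
      proof (cases "\<forall>e \<in> set (filtered \<pi> b X). f {e} < (1 + \<epsilon>) / 2 * f ?A")
        case True
        obtain S' where S': "good X S'" "f S' \<le> f S" using good[OF XE] by auto
        have "(1 - \<epsilon>) / 2 * f ?A \<le> f S'"
          using S'(1) X(4,5) cost' True unfolding good_def by blast
        then show ?thesis using S'(2) by linarith
      next
        case False
        then obtain e where e: "e \<in> set (filtered \<pi> b X)" "(1 + \<epsilon>) / 2 * f ?A \<le> f {e}"
          by (auto simp: not_less)
        have "e \<in> N" using e(1) set_permutation by (auto simp: filtered_def)
        have "b e \<le> B"
        proof (cases "e \<in> X")
          case True
          then show ?thesis using cost_member[of e X] X(2) A(1) costX by force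
        next
          case False
          then have "b e < \<epsilon> * B" using X(5)[OF e(1)] by simp
          also have "\<dots> \<le> 1 * B" using \<epsilon> budget_pos by (intro mult_right_mono) auto
          finally show ?thesis by simp
        qed
        then have "f {e} \<le> f S"
          using \<open>e \<in> N\<close> K2 by (intro guess) (simp add: setE cost_def)
        moreover have "(1 - \<epsilon>) / 2 * f ?A \<le> (1 + \<epsilon>) / 2 * f ?A"
          using f_nonneg[of ?A] A(1) \<epsilon> by (intro mult_right_mono) auto
        ultimately show ?thesis using e(2) by linarith
      qed
      moreover have "(1 / 2 - \<epsilon>) * f A \<le> (1 - \<epsilon>) / 2 * f ?A"
      proof -
        have "(1 - \<epsilon>) * (f A - f ?A) \<le> \<epsilon> * real K * (f A - f ?A)"
        proof (rule mult_right_mono)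
          show "1 - \<epsilon> \<le> \<epsilon> * real K" using K1 \<epsilon> by (simp add: field_simps)
          show "0 \<le> f A - f ?A" using f_mono[of ?A A] A(1) by auto
        qed
        also have "\<dots> \<le> \<epsilon> * f A" using X(6) \<epsilon> by (simp add: mult.assoc)
        finally show ?thesis by (simp add: field_simps)
      qed
      ultimately show ?thesis by linarith
    qed
    then show ?thesis using feasible A(3) by simp
  qed
  have last: "ensures f (best Ss) (length E) ?Q" if Ss: "list_all2 good E Ss" for Ss
  proof (intro ensures_weaken[OF ensures_best])
    show "length Ss \<le> length E" using list_all2_lengthD[OF Ss] by simp
    have "Ss \<noteq> []" using list_all2_lengthD[OF Ss] E_ne by auto
    then show "(if Ss = [] then S = {} else S \<in> set Ss) \<and> (\<forall>S' \<in> set Ss. f S' \<le> f S) \<Longrightarrow> ?Q S" for S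
      using outcome[OF Ss] by simp
  qed
  have run: "ensures f (enumerate_budget \<pi> b B \<epsilon>)
      (length E * (n + 2 * n * k + k + 1) + length E) ?Q"
    unfolding enumerate_budget_def E_def[symmetric] by (rule ensures_bind[OF steps last])
  show ?thesis
  proof (rule ensures_weaken[OF run])
    have "length E * (n + 2 * n * k + k + 1) + length E = length E * (n + 2 * n * k + k + 2)"
      by (simp add: algebra_simps)
    also have "\<dots> \<le> card {X. X \<subseteq> N \<and> card X \<le> K} * (n + 2 * n * k + k + 2)"
      using lenE by (rule mult_le_mono1)
    finally show "length E * (n + 2 * n * k + k + 1) + length E
        \<le> card {X. X \<subseteq> N \<and> card X \<le> K} * (n + 2 * n * k + k + 2)" .
  qed
qed

end

section \<open>The approximation and query guarantees\<close>

lemma approximatesI: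
  assumes "ensures f p c (\<lambda>S. S \<subseteq> N \<and> cost b S \<le> B \<and> \<alpha> * OPT N f b B \<le> f S)"
  shows "approximates \<alpha> N f b B p"
  using assms unfolding ensures_def approximates_def by fastforce

lemma queries_boundedI:
  assumes "ensures f p c Q" "real c \<le> d"
  shows "queries_bounded f p d"
  using assms unfolding ensures_def queries_bounded_def by fastforce

lemma parsing_queries_le:
  assumes "0 < \<epsilon>" "\<epsilon> < 1" "n \<ge> 2"
  shows "2 * real n + 2 * real n * num_thresholds \<epsilon> n + num_thresholds \<epsilon> n
    \<le> 16 * (real n / \<epsilon> * ln (real n))"
proof -
  let ?L = "ln (real n) / \<epsilon>" and ?k = "real (num_thresholds \<epsilon> n)"
  have k: "?k \<le> 4 * ?L" and one: "1 \<le> 2 * ?L"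
    using num_thresholds_le[of \<epsilon> n n] assms by auto
  \<comment> \<open>the constant: \<open>2 * (2 * L) + 3 * (4 * L) = 16 * L\<close> for \<open>L = ln n / \<epsilon>\<close>, as \<open>1 \<le> 2 * L\<close> and \<open>k \<le> 4 * L\<close>\<close>
  have "?k \<le> real n * ?k" using assms mult_right_mono[of 1 "real n" ?k] by simp
  then have "2 * real n + 2 * real n * ?k + ?k \<le> real n * (2 * 1 + 3 * ?k)"
    by (simp add: algebra_simps)
  also have "\<dots> \<le> real n * (2 * (2 * ?L) + 3 * (4 * ?L))"
    using k one by (intro mult_left_mono) auto
  also have "\<dots> = 16 * (real n / \<epsilon> * ln (real n))" by simp
  finally show ?thesis .
qed

lemma enumeration_queries_le:
  assumes "0 < \<epsilon>" "\<epsilon> < 1" "finite N" "card N \<ge> 2"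
  defines "n \<equiv> card N" and "k \<equiv> num_thresholds \<epsilon> (card N)"
  shows "real (card {X. X \<subseteq> N \<and> card X \<le> nat \<lfloor>1 / \<epsilon>\<rfloor>} * (n + 2 * n * k + k + 2))
    \<le> 32 * (1 / \<epsilon> * real n powr (1 + 1 / \<epsilon>) * ln (real n))"
proof -
  let ?K = "nat \<lfloor>1 / \<epsilon>\<rfloor>"
  have n: "n \<ge> 2" using assms by simp
  have "real n ^ ?K = real n powr real ?K" using n by (simp add: powr_realpow)
  also have "\<dots> \<le> real n powr (1 / \<epsilon>)"
  proof (rule powr_mono)
    show "real ?K \<le> 1 / \<epsilon>" using assms(1) by (simp add: of_nat_nat)
  qed (use n in simp)
  finally have "real (2 * n ^ ?K) \<le> 2 * real n powr (1 / \<epsilon>)" by simp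
  moreover have "real (card {X. X \<subseteq> N \<and> card X \<le> ?K}) \<le> real (2 * n ^ ?K)"
    unfolding of_nat_le_iff n_def using assms(3,4) by (rule card_small_subsets_le)
  ultimately have 1: "real (card {X. X \<subseteq> N \<and> card X \<le> ?K}) \<le> 2 * real n powr (1 / \<epsilon>)"
    by linarith
  have "n + 2 * n * k + k + 2 \<le> 2 * n + 2 * n * k + k" using n by simp
  then have "real (n + 2 * n * k + k + 2) \<le> real (2 * n + 2 * n * k + k)"
    by (simp only: of_nat_le_iff)
  also have "\<dots> \<le> 16 * (real n / \<epsilon> * ln (real n))"
    using parsing_queries_le[OF assms(1,2) n] unfolding k_def n_def by simp
  finally have 2: "real (n + 2 * n * k + k + 2) \<le> 16 * (real n / \<epsilon> * ln (real n))" .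
  have "real (card {X. X \<subseteq> N \<and> card X \<le> ?K} * (n + 2 * n * k + k + 2))
      \<le> 2 * real n powr (1 / \<epsilon>) * (16 * (real n / \<epsilon> * ln (real n)))"
    unfolding of_nat_mult using 1 2 by (intro mult_mono) auto
  also have "\<dots> = 32 * (1 / \<epsilon> * real n powr (1 + 1 / \<epsilon>) * ln (real n))"
    using n by (simp add: powr_add)
  finally show ?thesis .
qed

theorem theorem4:
  shows "(\<exists>c :: real. \<forall>(N :: 'a set) f \<pi> b B \<epsilon>.
            weak_order_budget N f \<pi> b B \<longrightarrow> 0 < \<epsilon> \<longrightarrow> \<epsilon> < 1 \<longrightarrow>
              approximates ((1 - \<epsilon>) / 3) N f b B (threshold_budget \<pi> b B \<epsilon>) \<and>
              (card N \<ge> 2 \<longrightarrow>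
                 queries_bounded f (threshold_budget \<pi> b B \<epsilon>)
                   (c * (real (card N) / \<epsilon> * ln (real (card N))))))
       \<and> (\<exists>c :: real. \<forall>(N :: 'a set) f \<pi> b B \<epsilon>.
            weak_order_budget N f \<pi> b B \<longrightarrow> 0 < \<epsilon> \<longrightarrow> \<epsilon> < 0.5 \<longrightarrow>
              approximates (0.5 - \<epsilon>) N f b B (enumerate_budget \<pi> b B \<epsilon>) \<and>
              (card N \<ge> 2 \<longrightarrow>
                 queries_bounded f (enumerate_budget \<pi> b B \<epsilon>)
                   (c * (1 / \<epsilon> * real (card N) powr (1 + 1 / \<epsilon>) * ln (real (card N))))))"
proof (intro conjI exI allI impI)
  fix N :: "'a set" and f \<pi> b and B \<epsilon> :: real
  assume W: "weak_order_budget N f \<pi> b B" and \<epsilon>: "0 < \<epsilon>" "\<epsilon> < 1"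
  note result = weak_order_budget.threshold_budget_ensures[OF W \<epsilon>]
  show "approximates ((1 - \<epsilon>) / 3) N f b B (threshold_budget \<pi> b B \<epsilon>)"
    using result by (rule approximatesI)
  assume "card N \<ge> 2"
  then show "queries_bounded f (threshold_budget \<pi> b B \<epsilon>)
      (16 * (real (card N) / \<epsilon> * ln (real (card N))))"
    using parsing_queries_le[OF \<epsilon>, of "card N"] by (intro queries_boundedI[OF result]) simp
next
  fix N :: "'a set" and f \<pi> b and B \<epsilon> :: real
  assume W: "weak_order_budget N f \<pi> b B" and \<epsilon>: "0 < \<epsilon>" "\<epsilon> < 0.5"
  have \<epsilon>': "\<epsilon> < 1 / 2" "\<epsilon> < 1" using \<epsilon> by auto
  note result = weak_order_budget.enumerate_budget_ensures[OF W \<epsilon>(1) \<epsilon>'(1)]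
  show "approximates (0.5 - \<epsilon>) N f b B (enumerate_budget \<pi> b B \<epsilon>)"
    using result by (intro approximatesI) simp
  assume "card N \<ge> 2"
  then show "queries_bounded f (enumerate_budget \<pi> b B \<epsilon>)
      (32 * (1 / \<epsilon> * real (card N) powr (1 + 1 / \<epsilon>) * ln (real (card N))))"
    using enumeration_queries_le[OF \<epsilon>(1) \<epsilon>'(2) weak_order_budget.finite_ground[OF W]]
    by (intro queries_boundedI[OF result])
qed

end
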